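(* Let $p$ be a prime number, let $s$ be an even positive divisor of $p-1$, and let $\mathbb{K}$ be the unique subfield of $\mathbb{Q}(\zeta_p)$ with $[\mathbb{K}:\mathbb{Q}]=s$. Let $\mathcal{M}_p\subseteq\mathcal{O}_{\mathbb{K}}$ be the $\mathbb{Z}$-submodule and $\sigma$ the canonical embedding defined in the context. Then the center density of the lattice $\sigma(\mathcal{M}_p)\subset\mathbb{R}^s$ satisfies $$\delta(\sigma(\mathcal{M}_p))\geq\frac{1}{2^s\sqrt{p}}.$$
   Context: Here $\zeta_p$ is a primitive $p$-th root of unity, $\mathbb{L}=\mathbb{Q}(\zeta_p)$, and $\mathcal{O}_{\mathbb{K}}$ is the ring of algebraic integers of $\mathbb{K}$. Let $u$ be an integer whose class generates $(\mathbb{Z}/p\mathbb{Z})^{\star}$, let $\sigma_u$ be the automorphism of $\mathbb{L}$ with $\sigma_u(\zeta_p)=\zeta_p^u$, let $\theta=\sigma_u|_{\mathbb{K}}$ (a generator of $\mathrm{Gal}(\mathbb{K}/\mathbb{Q})$), and let $t=\mathrm{Tr}_{\mathbb{L}/\mathbb{K}}(\zeta_p)$. The map $(a_0,\ldots,a_{s-1})\mapsto\sum_{i=0}^{s-1}a_i\theta^i(t)$ is an isomorphism of $\mathbb{Z}$-modules $\mathbb{Z}^s\to\mathcal{O}_{\mathbb{K}}$, and through it elements ${\bf x}\in\mathcal{O}_{\mathbb{K}}$ are identified with their coordinate vectors ${\bf x}=(a_0,\ldots,a_{s-1})\in\mathbb{Z}^s$. Let $\beta\in\mathbb{Z}$ be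 a primitive root modulo $p$ (of multiplicative order $p-1$ modulo $p$), and put $\alpha=\beta^{(p-1)/s}$. For $i=0,1,\ldots,s-1$ let $\mu_i=(1,\alpha^i,\alpha^{2i},\ldots,\alpha^{(s-1)i})\in\mathbb{Z}^s$, and let $\cdot$ denote the usual dot product on $\mathbb{Z}^s$. For $s$ even, $\mathcal{M}_p=\{{\bf x}\in\mathcal{O}_{\mathbb{K}}:{\bf x}\cdot\mu_i\equiv 0\pmod p\text{ for all } i=0,1,\ldots,\frac{s}{2}\}$. Canonical embedding: let $\sigma_1,\ldots,\sigma_s$ be the embeddings $\mathbb{K}\to\mathbb{C}$, with $\sigma_1,\ldots,\sigma_{r_1}$ real and $\sigma_{r_1+1},\ldots,\sigma_{r_1+r_2}$ representatives of the $r_2$ complex-conjugate pairs of non-real ones ($s=r_1+2r_2$). Then $\sigma:\mathbb{K}\to\mathbb{R}^s$ is $\sigma(x)=(\sigma_1(x),\ldots,\sigma_{r_1}(x),\mathrm{Re}\,\sigma_{r_1+1}(x),\mathrm{Im}\,\sigma_{r_1+1}(x),\ldots,\mathrm{Re}\,\sigma_{r_1+r_2}(x),\mathrm{Im}\,\sigma_{r_1+r_2}(x))$. For a full-rank lattice $\Lambda\subset\mathbb{R}^n$, the packing radius is $\rho=\frac12\min\{\|v\|:v\in\Lambda\setminus\{0\}\}$, the volume $\mathrm{vol}(\Lambda)$ is the square root of the determinant of a Gram matrix of a $\mathbb{Z}$-basis of $\Lambda$, and the center density is $\delta(\Lambda)=\rho^n/\mathrm{vol}(\Lambda)$. *)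

theory Defs
  imports
    Complex_Main
    "HOL-Library.FuncSet"
    "HOL-Computational_Algebra.Polynomial"
    "HOL-Number_Theory.Number_Theory"
    "Jordan_Normal_Form.Determinant"
begin

section \<open>Subfields of the complex numbers\<close>

definition complex_subfield :: "complex set \<Rightarrow> bool" where
  "complex_subfield F \<longleftrightarrow>
     0 \<in> F \<and> 1 \<in> F \<and>
     (\<forall>x\<in>F. \<forall>y\<in>F. x + y \<in> F \<and> x * y \<in> F) \<and>
     (\<forall>x\<in>F. - x \<in> F \<and> inverse x \<in> F)"

definition rat_adjoin :: "complex \<Rightarrow> complex set" where
  "rat_adjoin z = complex_subfield hull {z}"

definition rat_scale :: "rat \<Rightarrow> complex \<Rightarrow> complex" where
  "rat_scale q x = of_rat q * x"

lemma vector_space_rat_scale: "vector_space rat_scale"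
  by unfold_locales (simp_all add: rat_scale_def algebra_simps of_rat_add of_rat_mult)

text \<open>The library dimension is 0 for infinite-dimensional spaces, so \<open>field_degree K = s\<close> with
  \<open>s > 0\<close> says that the degree is finite and equal to \<open>s\<close>.\<close>
definition field_degree :: "complex set \<Rightarrow> nat" where
  "field_degree K = vector_space.dim rat_scale K"

definition integer_ring :: "complex set \<Rightarrow> complex set" where
  "integer_ring K = {x \<in> K. algebraic_int x}"

definition primitive_root_of_unity :: "nat \<Rightarrow> complex \<Rightarrow> bool" where
  "primitive_root_of_unity n z \<longleftrightarrow> z ^ n = 1 \<and> (\<forall>k. 0 < k \<and> k < n \<longrightarrow> z ^ k \<noteq> 1)"

section \<open>Embeddings, automorphisms and the relative trace\<close>

text \<open>Maps on \<open>K\<close> are taken extensional (\<open>undefined\<close> outside \<open>K\<close>), so that each field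
  homomorphism \<open>K \<Rightarrow> \<complex>\<close> is represented by exactly one function.\<close>
definition embeddings :: "complex set \<Rightarrow> (complex \<Rightarrow> complex) set" where
  "embeddings K = {\<tau> \<in> extensional K. \<tau> 1 = 1 \<and>
     (\<forall>x\<in>K. \<forall>y\<in>K. \<tau> (x + y) = \<tau> x + \<tau> y \<and> \<tau> (x * y) = \<tau> x * \<tau> y)}"

definition automorphisms :: "complex set \<Rightarrow> (complex \<Rightarrow> complex) set" where
  "automorphisms L = {\<tau> \<in> embeddings L. bij_betw \<tau> L L}"

text \<open>\<open>Tr\<^bsub>L/K\<^esub>(x)\<close> as the sum of the images of \<open>x\<close> under the \<open>K\<close>-embeddings of \<open>L\<close>.\<close>
definition relative_trace :: "complex set \<Rightarrow> complex set \<Rightarrow> complex \<Rightarrow> complex" where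
  "relative_trace L K x = (\<Sum>\<tau> \<in> {\<tau> \<in> embeddings L. \<forall>y\<in>K. \<tau> y = y}. \<tau> x)"

section \<open>The canonical embedding\<close>

definition real_embeddings :: "complex set \<Rightarrow> (complex \<Rightarrow> complex) set" where
  "real_embeddings K = {\<tau> \<in> embeddings K. \<forall>x\<in>K. \<tau> x \<in> \<real>}"

definition conj_embedding :: "complex set \<Rightarrow> (complex \<Rightarrow> complex) \<Rightarrow> (complex \<Rightarrow> complex)" where
  "conj_embedding K \<tau> = restrict (\<lambda>x. cnj (\<tau> x)) K"

text \<open>\<open>rs\<close> lists \<open>\<sigma>\<^sub>1, \<dots>, \<sigma>\<^bsub>r\<^sub>1\<^esub>\<close>, and \<open>cs\<close> lists one embedding from each pair of non-real
  complex conjugate ones.\<close>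
definition embedding_order ::
    "complex set \<Rightarrow> (complex \<Rightarrow> complex) list \<Rightarrow> (complex \<Rightarrow> complex) list \<Rightarrow> bool" where
  "embedding_order K rs cs \<longleftrightarrow>
     distinct rs \<and> set rs = real_embeddings K \<and>
     distinct cs \<and> set cs \<subseteq> embeddings K - real_embeddings K \<and>
     (\<forall>\<tau> \<in> embeddings K - real_embeddings K. \<tau> \<in> set cs \<longleftrightarrow> conj_embedding K \<tau> \<notin> set cs)"

definition canonical_embedding ::
    "(complex \<Rightarrow> complex) list \<Rightarrow> (complex \<Rightarrow> complex) list \<Rightarrow> complex \<Rightarrow> real vec" where
  "canonical_embedding rs cs x =
     vec_of_list (map (\<lambda>\<tau>. Re (\<tau> x)) rs @ concat (map (\<lambda>\<tau>. [Re (\<tau> x), Im (\<tau> x)]) cs))"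

section \<open>Lattices in Euclidean space\<close>

definition eucl_norm :: "real vec \<Rightarrow> real" where
  "eucl_norm v = sqrt (v \<bullet> v)"

text \<open>The columns of the square matrix \<open>B\<close> are linearly independent over \<open>\<real>\<close> and their
  integer combinations are exactly the elements of \<open>\<Lambda>\<close>.\<close>
definition lattice_basis :: "nat \<Rightarrow> real mat \<Rightarrow> real vec set \<Rightarrow> bool" where
  "lattice_basis n B \<Lambda> \<longleftrightarrow>
     B \<in> carrier_mat n n \<and>
     (\<forall>c \<in> carrier_vec n. B *\<^sub>v c = 0\<^sub>v n \<longrightarrow> c = 0\<^sub>v n) \<and>
     \<Lambda> = {B *\<^sub>v map_vec of_int z | z :: int vec. z \<in> carrier_vec n}"

definition packing_radius :: "nat \<Rightarrow> real vec set \<Rightarrow> real" where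
  "packing_radius n \<Lambda> = (LEAST r. \<exists>v \<in> \<Lambda> - {0\<^sub>v n}. r = eucl_norm v) / 2"

definition lattice_volume :: "nat \<Rightarrow> real vec set \<Rightarrow> real" where
  "lattice_volume n \<Lambda> =
     (THE V. \<exists>B. lattice_basis n B \<Lambda> \<and> V = sqrt (det (transpose_mat B * B)))"

definition center_density :: "nat \<Rightarrow> real vec set \<Rightarrow> real" where
  "center_density n \<Lambda> = packing_radius n \<Lambda> ^ n / lattice_volume n \<Lambda>"

section \<open>The submodule\<close>

definition generates_units_mod :: "nat \<Rightarrow> int \<Rightarrow> bool" where
  "generates_units_mod p u \<longleftrightarrow>
     coprime u (int p) \<and> (\<forall>c. coprime c (int p) \<longrightarrow> (\<exists>k::nat. [u ^ k = c] (mod int p)))"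

text \<open>The library's \<open>ord\<close> is available for natural numbers only, hence the least residue
  of \<open>\<beta>\<close>.\<close>
definition primitive_root_mod :: "nat \<Rightarrow> int \<Rightarrow> bool" where
  "primitive_root_mod p \<beta> \<longleftrightarrow> ord p (nat (\<beta> mod int p)) = p - 1"

definition mu_vec :: "nat \<Rightarrow> int \<Rightarrow> nat \<Rightarrow> int vec" where
  "mu_vec s \<alpha> i = vec s (\<lambda>j. \<alpha> ^ (j * i))"

definition has_coordinates ::
    "nat \<Rightarrow> (complex \<Rightarrow> complex) \<Rightarrow> complex \<Rightarrow> complex \<Rightarrow> int vec \<Rightarrow> bool" where
  "has_coordinates s \<theta> t x a \<longleftrightarrow>
     a \<in> carrier_vec s \<and> x = (\<Sum>i<s. of_int (a $ i) * (\<theta> ^^ i) t)"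

definition M_module ::
    "nat \<Rightarrow> nat \<Rightarrow> complex set \<Rightarrow> (complex \<Rightarrow> complex) \<Rightarrow> complex \<Rightarrow> int \<Rightarrow> complex set" where
  "M_module p s K \<theta> t \<alpha> =
     {x \<in> integer_ring K. \<exists>a. has_coordinates s \<theta> t x a \<and>
        (\<forall>i \<le> s div 2. [a \<bullet> mu_vec s \<alpha> i = 0] (mod int p))}"

end

theory Submission
  imports Defs "Jordan_Normal_Form.Char_Poly"
begin

text \<open>Write an element of \<open>\<M>\<^sub>p\<close> as an integer combination of the \<open>s\<close> Gaussian periods with
  coefficients \<open>a\<close>, and put \<open>c = (p - 1) / s\<close>. The sum over the embeddings \<open>\<tau>\<close> of \<open>K\<close> of
  \<open>\<bar>\<tau> x\<bar>\<^sup>2\<close> equals \<open>p * \<Sum> a\<^sub>j\<^sup>2 - c * (\<Sum> a\<^sub>j)\<^sup>2\<close>, a positive definite form. The condition for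
  \<open>i = 0\<close> says \<open>p dvd \<Sum> a\<^sub>j\<close>. By Parseval modulo \<open>p\<close>, \<open>s * \<Sum> a\<^sub>j\<^sup>2\<close> is congruent to the sum over
  \<open>i\<close> modulo \<open>s\<close> of \<open>f (\<alpha>\<^sup>i) * f (\<alpha>\<^sup>-\<^sup>i)\<close>, where \<open>f\<close> is the polynomial with coefficients \<open>a\<close>; one of
  \<open>i\<close>, \<open>-i\<close> always lies in \<open>{0, \<dots>, s / 2}\<close>, so every term vanishes and \<open>p dvd \<Sum> a\<^sub>j\<^sup>2\<close>. Hence
  \<open>p\<^sup>2\<close> divides the form, and nonzero elements give a value of at least \<open>p\<^sup>2\<close>. The \<open>s / 2 + 1\<close>
  conditions have index \<open>p ^ (s / 2 + 1)\<close>, which determines the volume.\<close>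

section \<open>Lattices\<close>

text \<open>The exponents match as follows. The lattice of all combinations of periods has squared
  covolume \<open>p ^ (s - 1) / w ^ s\<close>, where w is 1 for real K and 2 otherwise; squaring the
  index adds 2 (s / 2 + 1) to the exponent of p, and s - 1 + s + 2 = 2 s + 1. Against a minimum of
  at least p / sqrt w, everything cancels except 2^s and sqrt p, and w drops out because both sides
  carry it to the power s / 2. The obstacle is that K is known only as a subfield of degree s: its
  embeddings, the order of \<sigma> on it and its description as a fixed field have to be extracted
  by rational linear algebra. Averaging over powers of \<sigma> shows that fixed elements are
  combinations of periods, and independence of embeddings bounds their number. Volume and minimum
  are given by description operators, so their well-definedness is part of the claim.\<close>

lemma map_vec_of_int_unit: "map_vec of_int (unit_vec n j :: int vec) = (unit_vec n j :: real vec)"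
  by (rule eq_vecI) (auto simp: unit_vec_def)

text \<open>The columns of \<open>B'\<close> lie in the lattice, so \<open>B'\<close> is
  \<open>B\<close> times an integer matrix; \<open>k\<close> is the determinant of that
  matrix.\<close>

lemma lattice_basis_change:
  assumes "lattice_basis n B \<Lambda>" and "lattice_basis n B' \<Lambda>"
  obtains k :: int where "det B' = det B * of_int k"
proof -
  have B: "B \<in> carrier_mat n n" and B': "B' \<in> carrier_mat n n"
    using assms by (auto simp: lattice_basis_def)
  have "\<exists>z::int vec. z \<in> carrier_vec n \<and> B' *\<^sub>v unit_vec n j = B *\<^sub>v map_vec of_int z" for j
  proof -
    have "B' *\<^sub>v map_vec of_int (unit_vec n j :: int vec) \<in> \<Lambda>"
      using assms(2) unit_vec_carrier unfolding lattice_basis_def by blast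
    then show ?thesis
      using assms(1) unfolding lattice_basis_def map_vec_of_int_unit by blast
  qed
  then obtain z where z: "\<And>j. z j \<in> carrier_vec n"
    "\<And>j. B' *\<^sub>v unit_vec n j = B *\<^sub>v map_vec of_int (z j :: int vec)"
    by metis
  define Z where "Z = mat n n (\<lambda>(i, j). z j $ i)"
  have Z: "Z \<in> carrier_mat n n" by (simp add: Z_def)
  have "B' = B * map_mat of_int Z"
  proof (rule mat_col_eqI)
    fix j assume j: "j < dim_col (B * map_mat of_int Z)"
    then have jn: "j < n" using Z by simp
    have "col B' j = B' *\<^sub>v unit_vec n j"
      using B' jn by (intro eq_vecI) (auto simp: row_def)
    also have "\<dots> = B *\<^sub>v map_vec of_int (z j)" by (rule z)
    also have "map_vec of_int (z j) = col (map_mat of_int Z :: real mat) j"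
      using jn z(1)[of j] by (intro eq_vecI) (auto simp: Z_def)
    also have "B *\<^sub>v \<dots> = col (B * map_mat of_int Z) j"
      using B Z jn by (intro eq_vecI) auto
    finally show "col B' j = col (B * map_mat of_int Z) j" .
  qed (use B B' Z in auto)
  then have "det B' = det B * of_int (det Z)"
    using B Z by (simp add: det_mult[of _ n])
  then show ?thesis by (rule that)
qed

lemma lattice_basis_det_nonzero:
  assumes "lattice_basis n B \<Lambda>"
  shows "det B \<noteq> 0"
  using assms det_0_iff_vec_prod_zero_field[of B n] unfolding lattice_basis_def by blast

text \<open>\<open>THE\<close> needs one common value: the determinants of two bases are integer
  multiples of each other, so the factors are 1 or -1 and the absolute value is an
  invariant.\<close>

lemma lattice_volume_eq:
  assumes "lattice_basis n B \<Lambda>"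
  shows "lattice_volume n \<Lambda> = sqrt (det (transpose_mat B * B))"
proof -
  have sq: "sqrt (det (transpose_mat C * C)) = \<bar>det C\<bar>" if "lattice_basis n C \<Lambda>" for C
  proof -
    have "C \<in> carrier_mat n n" using that by (simp add: lattice_basis_def)
    then have "det (transpose_mat C * C) = det C ^ 2"
      by (simp add: det_mult[of _ n] det_transpose power2_eq_square)
    then show ?thesis by simp
  qed
  have abs_eq: "\<bar>det C\<bar> = \<bar>det B\<bar>" if C: "lattice_basis n C \<Lambda>" for C
  proof -
    obtain k l where kl: "det C = det B * of_int k" "det B = det C * of_int l"
      using lattice_basis_change[OF assms C] lattice_basis_change[OF C assms] by metis
    then have "det B * of_int (k * l) = det B * 1" by (metis mult.assoc mult.right_neutral of_int_mult)
    then have "of_int (k * l) = (1 :: real)"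
      using lattice_basis_det_nonzero[OF assms] by (metis mult_cancel_left)
    then have "k * l = 1" by linarith
    then have "\<bar>k\<bar> = 1" by (metis abs_zmult_eq_1 abs_one)
    then show ?thesis unfolding kl(1) abs_mult by (simp flip: of_int_abs)
  qed
  show ?thesis
    unfolding lattice_volume_def
  proof (rule the_equality)
    show "\<exists>C. lattice_basis n C \<Lambda> \<and>
        sqrt (det (transpose_mat B * B)) = sqrt (det (transpose_mat C * C))"
      using assms by blast
    show "V = sqrt (det (transpose_mat B * B))"
      if "\<exists>C. lattice_basis n C \<Lambda> \<and> V = sqrt (det (transpose_mat C * C))" for V
      using that abs_eq sq assms by metis
  qed
qed

text \<open>\<open>LEAST\<close> over the reals is meaningful only if the minimum is attained.
  Integrality of \<open>w * (v \<bullet> v)\<close> moves the question to the natural numbers, which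
  are well ordered.\<close>

lemma packing_radius_ge:
  fixes w r :: real
  assumes "w > 0"
    and "\<exists>v. v \<in> \<Lambda> - {0\<^sub>v n}"
    and int: "\<And>v. v \<in> \<Lambda> - {0\<^sub>v n} \<Longrightarrow> \<exists>q::nat. w * (v \<bullet> v) = real q"
    and ge: "\<And>v. v \<in> \<Lambda> - {0\<^sub>v n} \<Longrightarrow> r \<le> eucl_norm v"
  shows "packing_radius n \<Lambda> \<ge> r / 2"
proof -
  define P where "P q \<longleftrightarrow> (\<exists>v \<in> \<Lambda> - {0\<^sub>v n}. w * (v \<bullet> v) = real q)" for q
  obtain v0 q0 where "v0 \<in> \<Lambda> - {0\<^sub>v n}" "w * (v0 \<bullet> v0) = real q0"
    using assms(2) int by blast
  then have "P q0" unfolding P_def by blast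
  then have PL: "P (Least P)" by (rule LeastI)
  then obtain v where v: "v \<in> \<Lambda> - {0\<^sub>v n}" "w * (v \<bullet> v) = real (Least P)"
    unfolding P_def by blast
  have min: "eucl_norm v \<le> eucl_norm v'" if v': "v' \<in> \<Lambda> - {0\<^sub>v n}" for v'
  proof -
    obtain q where q: "w * (v' \<bullet> v') = real q" using int v' by blast
    then have "P q" using v' unfolding P_def by blast
    then have "Least P \<le> q" by (rule Least_le)
    then have "w * (v \<bullet> v) \<le> w * (v' \<bullet> v')" using v(2) q by simp
    then show ?thesis using assms(1) by (simp add: eucl_norm_def)
  qed
  have "(LEAST r. \<exists>v \<in> \<Lambda> - {0\<^sub>v n}. r = eucl_norm v) = eucl_norm v"
    using v(1) min by (intro Least_equality) auto
  then show ?thesis using ge[OF v(1)] by (simp add: packing_radius_def)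
qed

text \<open>This is a I - c J with J the all-ones matrix. For \<open>a = p\<close> and
  \<open>c = (p - 1) / s\<close> it is, up to the factor \<open>1 / w\<close>, the Gram matrix of
  the embedded periods.\<close>

definition scalar_minus_const_mat :: "nat \<Rightarrow> 'a :: comm_ring_1 \<Rightarrow> 'a \<Rightarrow> 'a mat" where
  "scalar_minus_const_mat n a c = mat n n (\<lambda>(i, j). (if i = j then a else 0) - c)"

lemma scalar_minus_const_mat_carrier [simp]:
  "scalar_minus_const_mat n a c \<in> carrier_mat n n"
  "dim_row (scalar_minus_const_mat n a c) = n" "dim_col (scalar_minus_const_mat n a c) = n"
  by (simp_all add: scalar_minus_const_mat_def)

text \<open>The all-ones vector is an eigenvector for \<open>a - n c\<close>. Conjugation by a
  unipotent matrix with that vector as first column makes the matrix upper triangular without any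
  division, hence over every commutative ring.\<close>

lemma det_scalar_minus_const_mat:
  fixes a c :: "'a :: comm_ring_1"
  assumes "n > 0"
  shows "det (scalar_minus_const_mat n a c) = (a - of_nat n * c) * a ^ (n - 1)"
proof -
  define M where "M = scalar_minus_const_mat n a c"
  define G :: "'a mat" where
    "G = mat n n (\<lambda>(i, j). (if j = i then 1 else 0) + (if j = 0 then if i = 0 then 0 else 1 else 0))"
  define U where "U = mat n n (\<lambda>(i, j). (if i = j then a else 0) -
     (if i = 0 then if j = 0 then of_nat n * c else c else 0))"
  have car: "M \<in> carrier_mat n n" "G \<in> carrier_mat n n" "U \<in> carrier_mat n n"
    by (simp_all add: M_def G_def U_def)
  have "M * G = G * U"
  proof (rule eq_matI)
    fix i j assume "i < dim_row (G * U)" "j < dim_col (G * U)"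
    then have ij: "i < n" "j < n" using car by auto
    have "(M * G) $$ (i, j) = (\<Sum>l<n. M $$ (i, l) * G $$ (l, j))"
      using ij car by (auto simp: scalar_prod_def atLeast0LessThan)
    also have "\<dots> = (\<Sum>l<n. (if l = j then M $$ (i, l) else 0) +
        (if j = 0 then M $$ (i, l) - (if l = 0 then M $$ (i, l) else 0) else 0))"
      using ij by (intro sum.cong) (auto simp: G_def)
    also have "\<dots> = (if j = 0 then \<Sum>l<n. M $$ (i, l) else M $$ (i, j))"
      using ij by (simp add: sum.distrib sum_subtractf)
    also have "(\<Sum>l<n. M $$ (i, l)) = a - of_nat n * c"
      using ij by (simp add: M_def scalar_minus_const_mat_def sum_subtractf)
    finally have l: "(M * G) $$ (i, j) = (if j = 0 then a - of_nat n * c else M $$ (i, j))" .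
    have "(G * U) $$ (i, j) = (\<Sum>l<n. G $$ (i, l) * U $$ (l, j))"
      using ij car by (auto simp: scalar_prod_def atLeast0LessThan)
    also have "\<dots> = (\<Sum>l<n. (if l = i then U $$ (l, j) else 0) +
        (if l = 0 then if i = 0 then 0 else U $$ (l, j) else 0))"
      using ij by (intro sum.cong) (auto simp: G_def)
    also have "\<dots> = U $$ (i, j) + (if i = 0 then 0 else U $$ (0, j))"
      using ij by (simp add: sum.distrib)
    also have "\<dots> = (if j = 0 then a - of_nat n * c else M $$ (i, j))"
      using ij by (auto simp: U_def M_def scalar_minus_const_mat_def)
    finally show "(M * G) $$ (i, j) = (G * U) $$ (i, j)" using l by simp
  qed (use car in auto)
  then have "det M * det G = det G * det U"
    using car by (metis det_mult)
  moreover have "det G = 1"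
    by (subst det_lower_triangular[of n]) (auto simp: G_def prod_list_diag_prod intro!: prod.neutral)
  moreover have "det U = (a - of_nat n * c) * a ^ (n - 1)"
  proof -
    have "det U = (\<Prod>i<n. U $$ (i, i))"
      using car by (subst det_upper_triangular[of _ n])
        (auto simp: U_def prod_list_diag_prod atLeast0LessThan)
    also have "{..<n} = insert 0 {1..<n}" using assms by auto
    also have "(\<Prod>i\<in>insert 0 {1..<n}. U $$ (i, i)) = (a - of_nat n * c) * (\<Prod>i=1..<n. U $$ (i, i))"
      using assms by (simp add: U_def)
    also have "(\<Prod>i=1..<n. U $$ (i, i)) = (\<Prod>i=1..<n. a)"
      by (rule prod.cong) (auto simp: U_def)
    finally show ?thesis by simp
  qed
  ultimately show ?thesis by (simp add: M_def)
qed

section \<open>Integer vectors as polynomials\<close>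

text \<open>Cauchy-Schwarz against the all-ones vector, read off from the nonnegative double sum of
  \<open>(a i - a j)^2\<close>; without roots or division it is available over the integers.\<close>

lemma sum_squared_le:
  fixes a :: "'b \<Rightarrow> 'a :: linordered_idom"
  shows "(\<Sum>i\<in>A. a i)\<^sup>2 \<le> of_nat (card A) * (\<Sum>i\<in>A. (a i)\<^sup>2)"
proof -
  let ?n = "of_nat (card A) :: 'a"
  have "(\<Sum>i\<in>A. \<Sum>j\<in>A. (a i - a j)\<^sup>2) =
      (\<Sum>i\<in>A. \<Sum>j\<in>A. (a i)\<^sup>2) + (\<Sum>i\<in>A. \<Sum>j\<in>A. (a j)\<^sup>2) - 2 * (\<Sum>i\<in>A. \<Sum>j\<in>A. a i * a j)"
    by (simp add: power2_diff sum.distrib sum_subtractf sum_distrib_left mult.assoc)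
  also have "\<dots> = 2 * (?n * (\<Sum>i\<in>A. (a i)\<^sup>2) - (\<Sum>i\<in>A. a i)\<^sup>2)"
    by (simp add: power2_eq_square sum_product sum_distrib_left algebra_simps)
  finally have "2 * (?n * (\<Sum>i\<in>A. (a i)\<^sup>2) - (\<Sum>i\<in>A. a i)\<^sup>2) =
      (\<Sum>i\<in>A. \<Sum>j\<in>A. (a i - a j)\<^sup>2)" by simp
  also have "\<dots> \<ge> 0" by (simp add: sum_nonneg)
  finally have "2 * (?n * (\<Sum>i\<in>A. (a i)\<^sup>2) - (\<Sum>i\<in>A. a i)\<^sup>2) \<ge> 0" .
  then show ?thesis by (simp add: zero_le_mult_iff)
qed

text \<open>Turns the dot product with \<open>mu_vec s \<alpha> i\<close> into evaluation at
  \<open>\<alpha> ^ i\<close>.\<close>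

definition vec_poly :: "'a :: comm_ring_1 vec \<Rightarrow> 'a poly" where
  "vec_poly a = (\<Sum>j<dim_vec a. monom (a $ j) j)"

lemma coeff_vec_poly: "coeff (vec_poly a) i = (if i < dim_vec a then a $ i else 0)"
  by (simp add: vec_poly_def coeff_sum)

lemma scalar_prod_mu_vec:
  assumes "a \<in> carrier_vec s"
  shows "a \<bullet> mu_vec s \<alpha> i = poly (vec_poly a) (\<alpha> ^ i)"
  using assms
  by (auto simp: scalar_prod_def mu_vec_def vec_poly_def poly_sum poly_monom atLeast0LessThan
      mult.commute simp flip: power_mult intro!: sum.cong)

definition root_product :: "(nat \<Rightarrow> 'a :: idom) \<Rightarrow> nat \<Rightarrow> 'a poly" where
  "root_product x d = (\<Prod>i<d. [:- x i, 1:])"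

lemma degree_root_product: "degree (root_product x d) = d"
  by (simp add: root_product_def degree_prod_eq_sum_degree)

lemma monic_root_product: "lead_coeff (root_product x d) = 1"
  by (simp add: root_product_def lead_coeff_prod)

lemma root_product_nonzero: "root_product x d \<noteq> 0"
  using monic_root_product[of x d] by auto

lemma poly_root_product: "poly (root_product x d) y = (\<Prod>i<d. y - x i)"
  by (simp add: root_product_def poly_prod)

text \<open>Newton interpolation modulo \<open>p\<close>: the quotient \<open>q\<close> is divided
  by the next linear factor, and its remainder is a multiple of \<open>p\<close> because the earlier
  factors take values prime to \<open>p\<close> at the new point.\<close>

lemma vanishing_mod_prime_decompose:
  fixes f :: "int poly" and p :: int
  assumes p: "prime p"
    and distinct: "\<And>i j. i < j \<Longrightarrow> j < d \<Longrightarrow> \<not> p dvd x j - x i"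
    and van: "\<And>i. i < d \<Longrightarrow> p dvd poly f (x i)"
  shows "\<exists>q r. f = root_product x d * q + smult p r \<and> (\<forall>i\<ge>d. coeff r i = 0)"
  using distinct van
proof (induction d)
  case 0
  then show ?case by (intro exI[of _ f] exI[of _ 0]) (simp add: root_product_def)
next
  case (Suc d)
  then obtain q r where qr: "f = root_product x d * q + smult p r" "\<forall>i\<ge>d. coeff r i = 0"
    using less_Suc_eq by metis
  have "p dvd poly f (x d)" using Suc.prems(2) by blast
  then have "p dvd poly (root_product x d) (x d) * poly q (x d)"
    unfolding qr(1) by (simp add: dvd_add_left_iff)
  moreover have "\<not> p dvd poly (root_product x d) (x d)"
    unfolding poly_root_product using p Suc.prems(1)
    by (subst prime_dvd_prod_iff) auto
  ultimately have "p dvd poly q (x d)" using p by (simp add: prime_dvd_mult_iff)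
  then obtain c where c: "poly q (x d) = p * c" by blast
  define q' where "q' = synthetic_div q (x d)"
  have "q = [:- x d, 1:] * q' + [:p * c:]"
    using synthetic_div_correct'[of "x d" q] by (simp add: q'_def c)
  then have "root_product x d * q = root_product x d * ([:- x d, 1:] * q' + [:p * c:])" by simp
  also have "\<dots> = root_product x (Suc d) * q' + smult p (smult c (root_product x d))"
    by (simp add: root_product_def algebra_simps)
  \<comment> \<open>The remainder contributes \<open>p * c\<close> times a polynomial of degree
    \<open>d\<close>, which the bound \<open>Suc d\<close> on the new \<open>r\<close> just
    allows.\<close>
  finally have "f = root_product x (Suc d) * q' + smult p (smult c (root_product x d) + r)"
    using qr(1) by (simp add: smult_add_right)
  moreover have "\<forall>i\<ge>Suc d. coeff (smult c (root_product x d) + r) i = 0"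
    using qr(2) by (auto simp: coeff_eq_0 degree_root_product)
  ultimately show ?case by blast
qed

text \<open>The vectors whose polynomial vanishes modulo \<open>p\<close> at \<open>x 0, \<dots>, x (d - 1)\<close> are spanned by
  the coefficient vectors of \<open>p * X ^ j\<close> for \<open>j < d\<close> and of \<open>X ^ (j - d) * root_product x d\<close>
  for \<open>j \<ge> d\<close>, which form a triangular matrix.\<close>

definition vanishing_basis :: "nat \<Rightarrow> int \<Rightarrow> (nat \<Rightarrow> int) \<Rightarrow> nat \<Rightarrow> int mat" where
  "vanishing_basis s p x d =
     mat s s (\<lambda>(i, j). coeff (if j < d then monom p j else monom 1 (j - d) * root_product x d) i)"

lemma vanishing_basis_carrier [simp]:
  "vanishing_basis s p x d \<in> carrier_mat s s"
  "dim_row (vanishing_basis s p x d) = s" "dim_col (vanishing_basis s p x d) = s"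
  by (simp_all add: vanishing_basis_def)

text \<open>The first \<open>d\<close> diagonal entries are \<open>p\<close>, the others 1 since
  \<open>root_product\<close> is monic. The value is the index of the sublattice.\<close>

lemma det_vanishing_basis:
  assumes "d \<le> s"
  shows "det (vanishing_basis s p x d) = p ^ d"
proof -
  have "coeff (monom 1 (j - d) * root_product x d) i = 0" if "j < i" "d \<le> j" for i j
    using that degree_mult_le[of "monom 1 (j - d)" "root_product x d"]
    by (intro coeff_eq_0) (simp add: degree_root_product degree_monom_eq)
  then have "det (vanishing_basis s p x d) = (\<Prod>i<s. vanishing_basis s p x d $$ (i, i))"
    by (subst det_upper_triangular[of _ s])
      (auto simp: prod_list_diag_prod atLeast0LessThan vanishing_basis_def)
  also have "\<dots> = (\<Prod>i<s. if i < d then p else 1)"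
  proof (rule prod.cong)
    fix i assume "i \<in> {..<s}"
    moreover have "coeff (monom 1 (i - d) * root_product x d) i = 1" if "\<not> i < d"
      using that monic_root_product[of x d]
      by (simp add: coeff_monom_mult degree_root_product)
    ultimately show "vanishing_basis s p x d $$ (i, i) = (if i < d then p else 1)"
      by (simp add: vanishing_basis_def)
  qed simp
  also have "\<dots> = (\<Prod>i<d. p)"
    using assms by (intro prod.mono_neutral_cong_right) auto
  finally show ?thesis by simp
qed

text \<open>Brings a combination of the columns into the shape of the division statement: the first
  \<open>d\<close> coordinates are the coefficients of the remainder, the others those of the
  quotient.\<close>

lemma vec_poly_vanishing_basis:
  assumes "d \<le> s" and z: "z \<in> carrier_vec s"
  shows "vec_poly (vanishing_basis s p x d *\<^sub>v z) =
    (\<Sum>j<d. monom (p * z $ j) j) + (\<Sum>j<s-d. monom (z $ (j + d)) j) * root_product x d"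
proof -
  let ?b = "\<lambda>j. if j < d then monom p j else monom 1 (j - d) * root_product x d"
  have deg: "degree (?b j) < s" if "j < s" for j
    using that degree_mult_le[of "monom 1 (j - d)" "root_product x d"] degree_monom_le[of p j]
    by (auto simp: degree_root_product degree_monom_eq)
  have "vec_poly (vanishing_basis s p x d *\<^sub>v z) = (\<Sum>j<s. smult (z $ j) (?b j))"
  proof (rule poly_eqI)
    fix i
    have "coeff (\<Sum>j<s. smult (z $ j) (?b j)) i = (\<Sum>j<s. z $ j * coeff (?b j) i)"
      by (simp add: coeff_sum)
    also have "\<dots> = coeff (vec_poly (vanishing_basis s p x d *\<^sub>v z)) i"
    proof (cases "i < s")
      case True
      then show ?thesis using z
        by (auto simp: coeff_vec_poly vanishing_basis_def scalar_prod_def atLeast0LessThan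
            mult.commute intro!: sum.cong)
    next
      case False
      then have "coeff (?b j) i = 0" if "j < s" for j
        using deg[OF that] by (intro coeff_eq_0) linarith
      then show ?thesis using False
        by (auto simp: coeff_vec_poly vanishing_basis_def intro!: sum.neutral)
    qed
    finally show "coeff (vec_poly (vanishing_basis s p x d *\<^sub>v z)) i =
        coeff (\<Sum>j<s. smult (z $ j) (?b j)) i" by simp
  qed
  also have "{..<s} = {..<d} \<union> {d..<s}" using assms by auto
  also have "(\<Sum>j\<in>{..<d} \<union> {d..<s}. smult (z $ j) (?b j)) =
      (\<Sum>j<d. smult (z $ j) (?b j)) + (\<Sum>j=d..<s. smult (z $ j) (?b j))"
    by (rule sum.union_disjoint) auto
  also have "(\<Sum>j<d. smult (z $ j) (?b j)) = (\<Sum>j<d. monom (p * z $ j) j)"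
    by (rule sum.cong) (simp_all add: smult_monom mult.commute)
  also have "(\<Sum>j=d..<s. smult (z $ j) (?b j)) =
      (\<Sum>j=0+d..<(s-d)+d. smult (z $ j) (?b j))"
    using assms by simp
  also have "\<dots> = (\<Sum>j<s-d. smult (z $ (j+d)) (?b (j+d)))"
    by (subst sum.shift_bounds_nat_ivl) (simp add: atLeast0LessThan)
  also have "\<dots> = (\<Sum>j<s-d. monom (z $ (j + d)) j) * root_product x d"
    by (simp add: sum_distrib_right smult_monom flip: mult_smult_left)
  finally show ?thesis .
qed

lemma vanishing_basis_spans:
  assumes p: "prime p" and "d \<le> s"
    and distinct: "\<And>i j. i < j \<Longrightarrow> j < d \<Longrightarrow> \<not> p dvd x j - x i"
  shows "{a \<in> carrier_vec s. \<forall>i<d. p dvd poly (vec_poly a) (x i)} =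
    {vanishing_basis s p x d *\<^sub>v z |z. z \<in> carrier_vec s}"
proof (intro equalityI subsetI)
  fix a assume "a \<in> {vanishing_basis s p x d *\<^sub>v z |z. z \<in> carrier_vec s}"
  then obtain z where z: "z \<in> carrier_vec s" "a = vanishing_basis s p x d *\<^sub>v z" by blast
  have "p dvd poly (vec_poly a) (x i)" if "i < d" for i
  proof -
    have "poly (root_product x d) (x i) = 0"
      using that by (auto simp: poly_root_product intro: prod_zero)
    moreover have "p dvd poly (\<Sum>j<d. monom (p * z $ j) j) (x i)"
      by (auto simp: poly_sum poly_monom intro!: dvd_sum)
    ultimately show ?thesis
      unfolding z(2) vec_poly_vanishing_basis[OF assms(2) z(1)] by simp
  qed
  then show "a \<in> {a \<in> carrier_vec s. \<forall>i<d. p dvd poly (vec_poly a) (x i)}"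
    using z mult_mat_vec_carrier[OF vanishing_basis_carrier(1)] by simp
next
  fix a :: "int vec" assume "a \<in> {a \<in> carrier_vec s. \<forall>i<d. p dvd poly (vec_poly a) (x i)}"
  then have a: "a \<in> carrier_vec s" "\<forall>i<d. p dvd poly (vec_poly a) (x i)" by auto
  obtain q r where qr: "vec_poly a = root_product x d * q + smult p r" "\<forall>i\<ge>d. coeff r i = 0"
    using vanishing_mod_prime_decompose[of p d x "vec_poly a"] p distinct a(2) by metis
  \<comment> \<open>The monic factor of degree \<open>d\<close> keeps the leading coefficient of
    \<open>q\<close>, and \<open>p * r\<close> lives below degree \<open>d\<close>; so a term of
    \<open>q\<close> at \<open>s - d\<close> or above would give \<open>vec_poly a\<close> a
    coefficient at \<open>s\<close> or above.\<close>
  have q0: "coeff q i = 0" if "i \<ge> s - d" for i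
  proof (rule ccontr)
    assume "coeff q i \<noteq> 0"
    then have "q \<noteq> 0" by auto
    have "degree q \<ge> s - d"
      using le_degree[OF \<open>coeff q i \<noteq> 0\<close>] that by simp
    then have "degree (root_product x d * q) \<ge> s" "degree (root_product x d * q) = d + degree q"
      using assms(2) root_product_nonzero[of x d] \<open>q \<noteq> 0\<close>
      by (auto simp: degree_mult_eq degree_root_product)
    moreover have "lead_coeff (root_product x d * q) \<noteq> 0"
      using \<open>q \<noteq> 0\<close> root_product_nonzero[of x d] by simp
    ultimately have "coeff (vec_poly a) (d + degree q) \<noteq> 0"
      using qr by simp
    then show False
      using a(1) \<open>degree q \<ge> s - d\<close> by (auto simp: coeff_vec_poly split: if_splits)
  qed
  define z where "z = vec s (\<lambda>j. if j < d then coeff r j else coeff q (j - d))"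
  have z: "z \<in> carrier_vec s" by (simp add: z_def)
  have "(\<Sum>j<d. monom (p * z $ j) j) = smult p r"
    using qr(2) assms(2) by (intro poly_eqI) (auto simp: coeff_sum z_def)
  moreover have "(\<Sum>j<s-d. monom (z $ (j + d)) j) = q"
    using q0 by (intro poly_eqI) (auto simp: coeff_sum z_def)
  ultimately have eq: "vec_poly (vanishing_basis s p x d *\<^sub>v z) = vec_poly a"
    unfolding vec_poly_vanishing_basis[OF assms(2) z] qr(1) by (simp add: mult.commute)
  have "vanishing_basis s p x d *\<^sub>v z = a"
  proof (rule eq_vecI)
    fix i assume "i < dim_vec a"
    then show "(vanishing_basis s p x d *\<^sub>v z) $ i = a $ i"
      using arg_cong[OF eq, of "\<lambda>f. coeff f i"] a(1)
      by (auto simp: coeff_vec_poly split: if_splits)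
  qed (use a in auto)
  then show "a \<in> {vanishing_basis s p x d *\<^sub>v z |z. z \<in> carrier_vec s}" using z by blast
qed

section \<open>The trace form modulo p\<close>

lemma diff_dvd_poly_diff:
  fixes f :: "'a :: comm_ring_1 poly"
  shows "x - y dvd poly f x - poly f y"
proof -
  have "poly f x = poly ([:- y, 1:] * synthetic_div f y + [:poly f y:]) x"
    by (simp only: synthetic_div_correct')
  then have "poly f x - poly f y = (x - y) * poly (synthetic_div f y) x"
    by (simp add: algebra_simps)
  then show ?thesis by simp
qed

text \<open>Inverses modulo \<open>p\<close> are avoided by writing
  \<open>\<alpha> ^ (s - 1)\<close> for the inverse of \<alpha>. Distinctness of the powers gives
  the orthogonality relations, and \<open>p\<close> not dividing \<open>s\<close> cancels the factor
  \<open>s\<close>.\<close>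

lemma dvd_sum_squares_of_half_spectrum:
  fixes a :: "int vec" and p \<alpha> :: int
  assumes p: "prime p" and s: "\<not> p dvd int s" and a: "a \<in> carrier_vec s"
    and \<alpha>: "[\<alpha> ^ s = 1] (mod p)"
    and distinct: "\<And>i j. i < j \<Longrightarrow> j < s \<Longrightarrow> \<not> p dvd \<alpha> ^ j - \<alpha> ^ i"
    and van: "\<And>i. i \<le> s div 2 \<Longrightarrow> p dvd poly (vec_poly a) (\<alpha> ^ i)"
  shows "p dvd (\<Sum>j<s. (a $ j)\<^sup>2)"
proof -
  let ?f = "poly (vec_poly a)"
  have f: "?f y = (\<Sum>j<s. a $ j * y ^ j)" for y
    using a by (auto simp: vec_poly_def poly_sum poly_monom)
  have term0: "p dvd ?f (\<alpha> ^ i) * ?f (\<alpha> ^ ((s - 1) * i))" if i: "i < s" for i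
  proof (cases "i \<le> s div 2")
    case True
    then show ?thesis using van by simp
  next
    case False
    \<comment> \<open>Beyond \<open>s div 2\<close> the exponent reduces modulo \<open>s\<close> to
      \<open>s - i\<close>, which is at most \<open>s div 2\<close>.\<close>
    have e: "(s - 1) * i = s * (i - 1) + (s - i)"
    proof -
      obtain k where "s = Suc (i + k)" using i less_imp_Suc_add by blast
      moreover obtain l where "i = Suc l" using False by (cases i) auto
      ultimately show ?thesis by (simp add: algebra_simps)
    qed
    have "[(\<alpha> ^ s) ^ (i - 1) * \<alpha> ^ (s - i) = 1 ^ (i - 1) * \<alpha> ^ (s - i)] (mod p)"
      by (intro cong_mult cong_pow \<alpha> cong_refl)
    then have "p dvd \<alpha> ^ ((s - 1) * i) - \<alpha> ^ (s - i)"
      unfolding e power_add power_mult by (simp add: cong_iff_dvd_diff)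
    then have "p dvd ?f (\<alpha> ^ ((s - 1) * i)) - ?f (\<alpha> ^ (s - i))"
      by (rule dvd_trans[OF _ diff_dvd_poly_diff])
    moreover have "p dvd ?f (\<alpha> ^ (s - i))" using False by (intro van) simp
    ultimately have "p dvd ?f (\<alpha> ^ ((s - 1) * i))"
      by (simp add: dvd_diff_left_iff)
    then show ?thesis by simp
  qed
  \<comment> \<open>With \<open>r\<close> standing for \<open>\<alpha> ^ (j - k)\<close>, the sum
    times \<open>r - 1\<close> is \<open>r ^ s - 1\<close>, hence 0 modulo \<open>p\<close>; and
    \<open>r - 1\<close> is a unit modulo \<open>p\<close> unless \<open>j = k\<close>.\<close>
  have geo: "[(\<Sum>i<s. (\<alpha> ^ (j + (s - 1) * k)) ^ i) = (if j = k then int s else 0)] (mod p)"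
    if jk: "j < s" "k < s" for j k
  proof -
    define r where "r = \<alpha> ^ (j + (s - 1) * k)"
    have rk: "[r * \<alpha> ^ k = \<alpha> ^ j] (mod p)"
    proof -
      have "j + (s - 1) * k + k = j + s * k" using jk by (cases s) auto
      then have "r * \<alpha> ^ k = \<alpha> ^ j * (\<alpha> ^ s) ^ k"
        by (metis r_def power_add power_mult)
      moreover have "[\<alpha> ^ j * (\<alpha> ^ s) ^ k = \<alpha> ^ j * 1 ^ k] (mod p)"
        by (intro cong_mult cong_pow \<alpha> cong_refl)
      ultimately show ?thesis by simp
    qed
    have rs: "[r ^ s = 1] (mod p)"
      using cong_pow[OF \<alpha>, of "j + (s - 1) * k"]
      unfolding r_def power_mult[symmetric] mult.commute[of s] by simp
    have cop: "coprime (\<alpha> ^ k) p"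
    proof -
      have "coprime (\<alpha> ^ s) p" using \<alpha> by (metis cong_imp_coprime cong_sym coprime_1_left)
      then show ?thesis using jk by (cases "k = 0") auto
    qed
    show ?thesis
    proof (cases "j = k")
      case True
      then have "[1 * \<alpha> ^ k = r * \<alpha> ^ k] (mod p)" using rk by (simp add: cong_sym)
      then have "[1 = r] (mod p)" using cong_mult_rcancel[OF cop] by blast
      then have "[(\<Sum>i<s. r ^ i) = (\<Sum>i<s. 1 ^ i)] (mod p)"
        by (intro cong_sum cong_pow) (rule cong_sym)
      then show ?thesis using True by (simp add: r_def)
    next
      case False
      have "\<not> p dvd r - 1"
      proof
        assume "p dvd r - 1"
        then have "[r = 1] (mod p)" by (simp add: cong_iff_dvd_diff)
        then have "[r * \<alpha> ^ k = 1 * \<alpha> ^ k] (mod p)" by (intro cong_mult cong_refl)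
        then have "[\<alpha> ^ k = \<alpha> ^ j] (mod p)" using rk cong_trans cong_sym by (metis mult_1)
        then have "p dvd \<alpha> ^ k - \<alpha> ^ j" "p dvd \<alpha> ^ j - \<alpha> ^ k"
          by (simp_all add: cong_iff_dvd_diff dvd_diff_commute)
        then show False using False distinct jk by (metis linorder_neqE_nat)
      qed
      moreover have "p dvd (r - 1) * (\<Sum>i<s. r ^ i)"
        using rs by (simp add: cong_iff_dvd_diff power_diff_1_eq)
      ultimately have "p dvd (\<Sum>i<s. r ^ i)" using p by (simp add: prime_dvd_mult_iff)
      then show ?thesis using False by (simp add: r_def cong_0_iff)
    qed
  qed
  have "(\<Sum>i<s. ?f (\<alpha> ^ i) * ?f (\<alpha> ^ ((s - 1) * i))) =
      (\<Sum>i<s. \<Sum>j<s. \<Sum>k<s. a $ j * a $ k * (\<alpha> ^ (j + (s - 1) * k)) ^ i)"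
  proof (rule sum.cong)
    fix i
    have "(a $ j * (\<alpha> ^ i) ^ j) * (a $ k * (\<alpha> ^ ((s - 1) * i)) ^ k) =
        a $ j * a $ k * (\<alpha> ^ (j + (s - 1) * k)) ^ i" for j k
    proof -
      have "(\<alpha> ^ i) ^ j * (\<alpha> ^ ((s - 1) * i)) ^ k = (\<alpha> ^ (j + (s - 1) * k)) ^ i"
        by (simp add: algebra_simps flip: power_mult power_add)
      then show ?thesis by (simp add: algebra_simps)
    qed
    then show "?f (\<alpha> ^ i) * ?f (\<alpha> ^ ((s - 1) * i)) =
        (\<Sum>j<s. \<Sum>k<s. a $ j * a $ k * (\<alpha> ^ (j + (s - 1) * k)) ^ i)"
      by (simp only: f sum_product)
  qed simp
  also have "\<dots> = (\<Sum>j<s. \<Sum>i<s. \<Sum>k<s. a $ j * a $ k * (\<alpha> ^ (j + (s - 1) * k)) ^ i)"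
    by (rule sum.swap)
  also have "\<dots> = (\<Sum>j<s. \<Sum>k<s. \<Sum>i<s. a $ j * a $ k * (\<alpha> ^ (j + (s - 1) * k)) ^ i)"
    by (intro sum.cong refl sum.swap)
  also have "\<dots> = (\<Sum>j<s. \<Sum>k<s. a $ j * a $ k * (\<Sum>i<s. (\<alpha> ^ (j + (s - 1) * k)) ^ i))"
    by (simp add: sum_distrib_left)
  finally have eq: "(\<Sum>i<s. ?f (\<alpha> ^ i) * ?f (\<alpha> ^ ((s - 1) * i))) = \<dots>" .
  have "[\<dots> = (\<Sum>j<s. \<Sum>k<s. a $ j * a $ k * (if j = k then int s else 0))] (mod p)"
    by (intro cong_sum cong_mult cong_refl geo) auto
  also have "(\<Sum>j<s. \<Sum>k<s. a $ j * a $ k * (if j = k then int s else 0)) =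
      int s * (\<Sum>j<s. (a $ j)\<^sup>2)"
    by (simp add: if_distrib sum_distrib_left power2_eq_square mult_ac cong: if_cong)
  finally have "[(\<Sum>i<s. ?f (\<alpha> ^ i) * ?f (\<alpha> ^ ((s - 1) * i))) = int s * (\<Sum>j<s. (a $ j)\<^sup>2)] (mod p)"
    using eq by simp
  moreover have "p dvd (\<Sum>i<s. ?f (\<alpha> ^ i) * ?f (\<alpha> ^ ((s - 1) * i)))"
    using term0 by (intro dvd_sum) auto
  ultimately have "p dvd int s * (\<Sum>j<s. (a $ j)\<^sup>2)"
    by (simp add: cong_dvd_iff)
  then show ?thesis using p s by (simp add: prime_dvd_mult_iff)
qed

text \<open>Positivity is Cauchy-Schwarz: the subtracted term is at most c s times the sum of
  squares, and c s = p - 1, so at least one copy of the sum of squares remains.\<close>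

lemma trace_form_bounds:
  fixes a :: "int vec" and p c s :: nat
  assumes cs: "c * s = p - 1" "p > 0" and a: "a \<in> carrier_vec s" and "a \<noteq> 0\<^sub>v s"
    and "int p dvd (\<Sum>j<s. (a $ j)\<^sup>2)" and "int p dvd (\<Sum>j<s. a $ j)"
  shows "int p * (\<Sum>j<s. (a $ j)\<^sup>2) - int c * (\<Sum>j<s. a $ j)\<^sup>2 \<ge> (int p)\<^sup>2"
proof -
  let ?Q = "int p * (\<Sum>j<s. (a $ j)\<^sup>2) - int c * (\<Sum>j<s. a $ j)\<^sup>2"
  have "(int p)\<^sup>2 dvd ?Q"
  proof (rule dvd_diff)
    show "(int p)\<^sup>2 dvd int p * (\<Sum>j<s. (a $ j)\<^sup>2)"
      unfolding power2_eq_square[of "int p"] using assms(5) by (intro mult_dvd_mono) auto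
    show "(int p)\<^sup>2 dvd int c * (\<Sum>j<s. a $ j)\<^sup>2"
      using assms(6) by (intro dvd_mult dvd_power_same)
  qed
  moreover have "?Q > 0"
  proof -
    have "int c * (\<Sum>j<s. a $ j)\<^sup>2 \<le> int c * (int s * (\<Sum>j<s. (a $ j)\<^sup>2))"
      using sum_squared_le[of "\<lambda>j. a $ j" "{..<s}"] by (intro mult_left_mono) auto
    also have "\<dots> = (int p - 1) * (\<Sum>j<s. (a $ j)\<^sup>2)"
      using cs by (simp add: of_nat_diff flip: mult.assoc of_nat_mult)
    finally have "?Q \<ge> (\<Sum>j<s. (a $ j)\<^sup>2)" by (simp add: algebra_simps)
    moreover obtain j where "j < s" "a $ j \<noteq> 0" using a \<open>a \<noteq> 0\<^sub>v s\<close>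
      by (metis carrier_vecD eq_vecI index_zero_vec)
    then have "(\<Sum>j<s. (a $ j)\<^sup>2) > 0" by (intro sum_pos2[of _ j]) auto
    ultimately show ?thesis by linarith
  qed
  ultimately show ?thesis using zdvd_imp_le by blast
qed

section \<open>Center density from the Gram matrix\<close>

lemma norm_sq_of_gram:
  fixes E :: "real mat" and a :: "int vec" and p c s :: nat
  assumes E: "E \<in> carrier_mat s s" and a: "a \<in> carrier_vec s"
    and gram: "transpose_mat E * E = r \<cdot>\<^sub>m scalar_minus_const_mat s (real p) (real c)"
  shows "(E *\<^sub>v map_vec of_int a) \<bullet> (E *\<^sub>v map_vec of_int a) =
    r * of_int (int p * (\<Sum>j<s. (a $ j)\<^sup>2) - int c * (\<Sum>j<s. a $ j)\<^sup>2)"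
proof -
  let ?a = "map_vec of_int a :: real vec" and ?M = "scalar_minus_const_mat s (real p) (real c)"
  have "(E *\<^sub>v ?a) \<bullet> (E *\<^sub>v ?a) = (transpose_mat E *\<^sub>v (E *\<^sub>v ?a)) \<bullet> ?a"
    using E a by (subst transpose_vec_mult_scalar[of E s s]) auto
  also have "transpose_mat E *\<^sub>v (E *\<^sub>v ?a) = (r \<cdot>\<^sub>m ?M) *\<^sub>v ?a"
    using E a by (subst assoc_mult_mat_vec[symmetric, of _ s s _ s]) (auto simp: gram)
  also have "\<dots> = r \<cdot>\<^sub>v (?M *\<^sub>v ?a)"
    using a by (intro eq_vecI) (auto simp: scalar_minus_const_mat_def)
  also have "?M *\<^sub>v ?a = vec s (\<lambda>i. real p * of_int (a $ i) - real c * (\<Sum>j<s. of_int (a $ j)))"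
  proof (rule eq_vecI)
    fix i assume "i < dim_vec (vec s (\<lambda>i. real p * of_int (a $ i) - real c * (\<Sum>j<s. of_int (a $ j))))"
    then have i: "i < s" by simp
    have "(?M *\<^sub>v ?a) $ i = (\<Sum>j<s. ((if i = j then real p else 0) - real c) * of_int (a $ j))"
      using i a by (auto simp: scalar_minus_const_mat_def scalar_prod_def atLeast0LessThan
          intro!: sum.cong)
    also have "\<dots> = (\<Sum>j<s. (if i = j then real p * of_int (a $ j) else 0) - real c * of_int (a $ j))"
      by (intro sum.cong) (auto simp: algebra_simps)
    also have "\<dots> = real p * of_int (a $ i) - real c * (\<Sum>j<s. of_int (a $ j))"
      using i by (simp add: sum_subtractf sum_distrib_left)
    finally show "(?M *\<^sub>v ?a) $ i =
        vec s (\<lambda>i. real p * of_int (a $ i) - real c * (\<Sum>j<s. of_int (a $ j))) $ i"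
      using i by simp
  qed (simp add: scalar_minus_const_mat_def)
  also have "(r \<cdot>\<^sub>v \<dots>) \<bullet> ?a =
      (\<Sum>i<s. r * (real p * of_int (a $ i) - real c * (\<Sum>j<s. of_int (a $ j))) * of_int (a $ i))"
    using a by (auto simp: scalar_prod_def atLeast0LessThan intro!: sum.cong)
  also have "\<dots> = r * (real p * (\<Sum>i<s. (of_int (a $ i))\<^sup>2) - real c * (\<Sum>j<s. of_int (a $ j))\<^sup>2)"
    by (simp add: power2_eq_square sum_distrib_left sum_distrib_right sum_subtractf algebra_simps)
  finally show ?thesis by simp
qed

text \<open>Isolates the part without number fields. The columns of \<open>E\<close> are later the
  embedded periods, but here \<open>E\<close> enters only through its Gram matrix.\<close>

theorem center_density_ge_of_gram:
  fixes E :: "real mat" and p c s :: nat and w :: real and \<alpha> :: int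
  assumes p: "prime p" and s: "even s" "s > 0" and cs: "c * s = p - 1" and w: "w > 0"
    and E: "E \<in> carrier_mat s s"
    and gram: "transpose_mat E * E = (1 / w) \<cdot>\<^sub>m scalar_minus_const_mat s (real p) (real c)"
    and \<alpha>: "[\<alpha> ^ s = 1] (mod int p)"
    and distinct: "\<And>i j. i < j \<Longrightarrow> j < s \<Longrightarrow> \<not> int p dvd \<alpha> ^ j - \<alpha> ^ i"
  shows "center_density s ((\<lambda>a. E *\<^sub>v map_vec of_int a) `
      {a \<in> carrier_vec s. \<forall>i\<le>s div 2. [a \<bullet> mu_vec s \<alpha> i = 0] (mod int p)})
    \<ge> 1 / (2 ^ s * sqrt (real p))"
proof -
  define S where "S = {a \<in> carrier_vec s. \<forall>i\<le>s div 2. [a \<bullet> mu_vec s \<alpha> i = 0] (mod int p)}"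
  define \<Lambda> where "\<Lambda> = (\<lambda>a. E *\<^sub>v map_vec of_int a) ` S"
  define d where "d = s div 2 + 1"
  define U where "U = vanishing_basis s (int p) (\<lambda>i. \<alpha> ^ i) d"
  define B where "B = E * map_mat of_int U"
  have p0: "p > 0" using p prime_gt_0_nat by blast
  \<comment> \<open>Equality occurs for \<open>s = 2\<close>.\<close>
  have ds: "d \<le> s" using s by (auto simp: d_def elim!: evenE)
  have U: "U \<in> carrier_mat s s" by (simp add: U_def)
  have B: "B \<in> carrier_mat s s" using E U by (simp add: B_def)
  have S_iff: "a \<in> S \<longleftrightarrow> a \<in> carrier_vec s \<and> (\<forall>i<d. int p dvd poly (vec_poly a) (\<alpha> ^ i))" for a
    by (auto simp: S_def scalar_prod_mu_vec d_def cong_0_iff less_Suc_eq_le)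
  then have "S = {a \<in> carrier_vec s. \<forall>i<d. int p dvd poly (vec_poly a) (\<alpha> ^ i)}"
    by blast
  also have "\<dots> = {U *\<^sub>v z |z. z \<in> carrier_vec s}"
    unfolding U_def by (rule vanishing_basis_spans) (use p ds distinct in auto)
  finally have S_eq: "S = {U *\<^sub>v z |z. z \<in> carrier_vec s}" .
  have \<Lambda>_eq: "\<Lambda> = {B *\<^sub>v map_vec of_int z |z :: int vec. z \<in> carrier_vec s}"
  proof -
    have "E *\<^sub>v map_vec of_int (U *\<^sub>v z) = B *\<^sub>v map_vec of_int z" if "z \<in> carrier_vec s" for z
      using that E U by (simp add: B_def of_int_hom.mult_mat_vec_hom[of _ s s])
    then show ?thesis unfolding \<Lambda>_def S_eq by (auto simp: image_iff) metis+
  qed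
  have "(det E)\<^sup>2 = det (transpose_mat E * E)"
    using E by (simp add: det_mult[of _ s] det_transpose power2_eq_square)
  also have "\<dots> = (1 / w) ^ s * ((real p - real s * real c) * real p ^ (s - 1))"
    unfolding gram det_smult det_scalar_minus_const_mat[OF s(2)] by simp
  \<comment> \<open>The eigenvalue on the all-ones vector becomes \<open>p - s * c = 1\<close>, so
    only \<open>p ^ (s - 1)\<close> remains.\<close>
  also have "real s * real c = real p - 1"
    using cs p0 by (metis Suc_leI mult.commute of_nat_1 of_nat_diff of_nat_mult One_nat_def)
  finally have detE: "(det E)\<^sup>2 = (1 / w) ^ s * real p ^ (s - 1)" by simp
  have "det B = det E * real p ^ d"
    using E U ds by (simp add: B_def det_mult[of _ s] U_def det_vanishing_basis)
  then have "(det B)\<^sup>2 = (1 / w) ^ s * (real p ^ (s - 1) * (real p ^ d)\<^sup>2)"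
    by (simp add: power_mult_distrib detE)
  \<comment> \<open>The part \<open>2 * s\<close> of the exponent is absorbed by the minimum; the
    single extra factor \<open>p\<close> is the origin of the square root in the bound.\<close>
  also have "real p ^ (s - 1) * (real p ^ d)\<^sup>2 = real p ^ (2 * s + 1)"
  proof -
    have "s - 1 + 2 * d = 2 * s + 1" using s by (auto simp: d_def elim!: evenE)
    then show ?thesis by (metis power_add power_mult mult.commute)
  qed
  finally have "(det B)\<^sup>2 = (1 / w) ^ s * real p ^ (2 * s + 1)" .
  also have "\<dots> = (real p ^ s / sqrt w ^ s * sqrt (real p))\<^sup>2"
  proof -
    have "(sqrt w ^ s)\<^sup>2 = w ^ s"
      using w by (simp add: power_mult[symmetric] mult.commute[of s]) (simp add: power_mult)
    moreover have "real p ^ (2 * s + 1) = (real p ^ s)\<^sup>2 * real p"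
      by (simp add: power_mult[symmetric] mult.commute[of s])
    ultimately show ?thesis by (simp add: power_mult_distrib power_divide)
  qed
  finally have detB: "(det B)\<^sup>2 = (real p ^ s / sqrt w ^ s * sqrt (real p))\<^sup>2" .
  have basis: "lattice_basis s B \<Lambda>"
  proof -
    have "(det B)\<^sup>2 > 0"
      unfolding detB using w p0 by (intro zero_less_power mult_pos_pos divide_pos_pos) auto
    then have "det B \<noteq> 0" by auto
    then show ?thesis unfolding lattice_basis_def
      using B det_0_iff_vec_prod_zero_field[OF B] \<Lambda>_eq by blast
  qed
  have vol: "lattice_volume s \<Lambda> = real p ^ s / sqrt w ^ s * sqrt (real p)"
  proof -
    have "det (transpose_mat B * B) = (det B)\<^sup>2"
      using B by (simp add: det_mult[of _ s] det_transpose power2_eq_square)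
    then show ?thesis using w unfolding lattice_volume_eq[OF basis] detB by simp
  qed
  have norm: "\<exists>q. v \<bullet> v = of_int q / w \<and> q \<ge> (int p)\<^sup>2" if v: "v \<in> \<Lambda> - {0\<^sub>v s}" for v
  proof -
    obtain a where a: "a \<in> S" "v = E *\<^sub>v map_vec of_int a" using v unfolding \<Lambda>_def by blast
    have ac: "a \<in> carrier_vec s" using a(1) by (simp add: S_def)
    have "a \<noteq> 0\<^sub>v s"
    proof
      assume "a = 0\<^sub>v s"
      then have "map_vec of_int a = (0\<^sub>v s :: real vec)" by auto
      then have "v = E *\<^sub>v 0\<^sub>v s" by (simp only: a(2))
      then have "v = 0\<^sub>v s" using E by auto
      then show False using v by simp
    qed
    have van: "int p dvd poly (vec_poly a) (\<alpha> ^ i)" if "i \<le> s div 2" for i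
      using that a(1) by (auto simp: S_iff d_def)
    \<comment> \<open>\<open>s\<close> divides \<open>p - 1\<close>, which is positive and smaller
      than \<open>p\<close>.\<close>
    have "\<not> p dvd s"
    proof
      assume "p dvd s"
      then have "p dvd p - 1" using cs by (metis dvd_mult)
      moreover have "p - 1 > 0" using cs s prime_gt_1_nat[OF p] by simp
      ultimately have "p \<le> p - 1" by (rule dvd_imp_le)
      then show False using p0 by simp
    qed
    then have "int p dvd (\<Sum>j<s. (a $ j)\<^sup>2)"
      using dvd_sum_squares_of_half_spectrum[of "int p" s a \<alpha>] p ac \<alpha> distinct van by simp
    \<comment> \<open>The condition for \<open>i = 0\<close> evaluates at 1, which is the
      coefficient sum.\<close>
    moreover have "int p dvd (\<Sum>j<s. a $ j)"
      using van[of 0] ac by (simp add: vec_poly_def poly_sum poly_monom)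
    ultimately have "int p * (\<Sum>j<s. (a $ j)\<^sup>2) - int c * (\<Sum>j<s. a $ j)\<^sup>2 \<ge> (int p)\<^sup>2"
      using trace_form_bounds[OF cs p0 ac \<open>a \<noteq> 0\<^sub>v s\<close>] by blast
    then show ?thesis
      unfolding a(2) norm_sq_of_gram[OF E ac gram] by (metis mult.commute times_divide_eq_right mult_1_right)
  qed
  have "packing_radius s \<Lambda> \<ge> (real p / sqrt w) / 2"
  proof (rule packing_radius_ge[OF w])
    have "B *\<^sub>v map_vec of_int (unit_vec s 0) \<in> \<Lambda>" unfolding \<Lambda>_eq
      by (intro CollectI exI[of _ "unit_vec s 0"]) simp
    moreover have "B *\<^sub>v map_vec of_int (unit_vec s 0) \<noteq> 0\<^sub>v s"
      using basis s(2) unfolding lattice_basis_def map_vec_of_int_unit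
      by (metis unit_vec_carrier unit_vec_nonzero)
    ultimately show "\<exists>v. v \<in> \<Lambda> - {0\<^sub>v s}" by blast
  next
    fix v assume "v \<in> \<Lambda> - {0\<^sub>v s}"
    then obtain q where q: "v \<bullet> v = of_int q / w" "q \<ge> (int p)\<^sup>2" using norm by blast
    then have "q \<ge> 0" by (meson order_trans zero_le_power2)
    then show "\<exists>q::nat. w * (v \<bullet> v) = real q"
      using q(1) w by (intro exI[of _ "nat q"]) simp
    have "(real p)\<^sup>2 \<le> of_int q" using q(2) by (metis of_int_le_iff of_int_of_nat_eq of_int_power)
    then have "(real p)\<^sup>2 / w \<le> v \<bullet> v" using q(1) w by (simp add: divide_right_mono)
    then have "sqrt ((real p)\<^sup>2 / w) \<le> eucl_norm v" by (simp add: eucl_norm_def)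
    then show "real p / sqrt w \<le> eucl_norm v" by (simp add: real_sqrt_divide)
  qed
  then have "packing_radius s \<Lambda> ^ s \<ge> ((real p / sqrt w) / 2) ^ s"
    using w by (intro power_mono) auto
  then have "center_density s \<Lambda> \<ge> ((real p / sqrt w) / 2) ^ s / (real p ^ s / sqrt w ^ s * sqrt (real p))"
    unfolding center_density_def vol using w by (intro divide_right_mono) auto
  also have "((real p / sqrt w) / 2) ^ s / (real p ^ s / sqrt w ^ s * sqrt (real p)) =
      1 / (2 ^ s * sqrt (real p))"
    using w p0 by (simp add: power_divide field_simps)
  finally show ?thesis unfolding \<Lambda>_def S_def .
qed

section \<open>Field embeddings\<close>

interpretation ratvs: vector_space rat_scale
  by (rule vector_space_rat_scale)

text \<open>\<open>embeddings\<close> without extensionality: this form composes and passes to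
  subfields, so it fits powers of \<sigma> and complex conjugation alike.\<close>

definition field_hom_on :: "complex set \<Rightarrow> (complex \<Rightarrow> complex) \<Rightarrow> bool" where
  "field_hom_on F \<tau> \<longleftrightarrow> \<tau> 1 = 1 \<and>
     (\<forall>x\<in>F. \<forall>y\<in>F. \<tau> (x + y) = \<tau> x + \<tau> y \<and> \<tau> (x * y) = \<tau> x * \<tau> y)"

lemma mem_embeddings_iff: "\<tau> \<in> embeddings F \<longleftrightarrow> \<tau> \<in> extensional F \<and> field_hom_on F \<tau>"
  by (auto simp: embeddings_def field_hom_on_def)

lemma field_hom_on_mono: "field_hom_on F \<tau> \<Longrightarrow> K \<subseteq> F \<Longrightarrow> field_hom_on K \<tau>"
  by (auto simp: field_hom_on_def)

lemma field_hom_on_comp: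
  "field_hom_on F \<tau> \<Longrightarrow> \<tau> ` F \<subseteq> K \<Longrightarrow> field_hom_on K \<rho> \<Longrightarrow> field_hom_on F (\<rho> \<circ> \<tau>)"
  by (auto simp: field_hom_on_def image_subset_iff)

lemma
  assumes "complex_subfield F"
  shows subfield_zero: "0 \<in> F" and subfield_one: "1 \<in> F"
    and subfield_add: "\<And>x y. x \<in> F \<Longrightarrow> y \<in> F \<Longrightarrow> x + y \<in> F"
    and subfield_mult: "\<And>x y. x \<in> F \<Longrightarrow> y \<in> F \<Longrightarrow> x * y \<in> F"
    and subfield_uminus: "\<And>x. x \<in> F \<Longrightarrow> - x \<in> F"
    and subfield_inverse: "\<And>x. x \<in> F \<Longrightarrow> inverse x \<in> F"
  using assms by (auto simp: complex_subfield_def)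

lemma subfield_of_nat: "complex_subfield F \<Longrightarrow> of_nat n \<in> F"
  by (induction n) (auto intro: subfield_zero subfield_one subfield_add)

lemma subfield_of_int: "complex_subfield F \<Longrightarrow> of_int n \<in> F"
  by (cases n) (auto intro!: subfield_of_nat subfield_uminus simp del: of_nat_Suc)

lemma subfield_of_rat: "complex_subfield F \<Longrightarrow> of_rat q \<in> F"
  by (cases q) (auto simp: of_rat_rat divide_inverse
    intro!: subfield_mult subfield_inverse subfield_of_int)

lemma subfield_power: "complex_subfield F \<Longrightarrow> x \<in> F \<Longrightarrow> x ^ n \<in> F"
  by (induction n) (auto intro: subfield_one subfield_mult)

lemma subfield_sum:
  "complex_subfield F \<Longrightarrow> (\<And>i. i \<in> A \<Longrightarrow> f i \<in> F) \<Longrightarrow> sum f A \<in> F"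
  by (induction A rule: infinite_finite_induct) (auto intro: subfield_zero subfield_add)

lemma subfield_subspace: "complex_subfield F \<Longrightarrow> ratvs.subspace F"
  unfolding ratvs.subspace_def rat_scale_def
  by (auto intro: subfield_zero subfield_add subfield_mult subfield_of_rat)

lemma restrict_mem_embeddings:
  assumes "complex_subfield F" and "field_hom_on F \<tau>"
  shows "restrict \<tau> F \<in> embeddings F"
  using assms subfield_one subfield_add subfield_mult
  by (auto simp: mem_embeddings_iff field_hom_on_def)

context
  fixes F :: "complex set" and \<tau> :: "complex \<Rightarrow> complex"
  assumes F: "complex_subfield F" and hom: "field_hom_on F \<tau>"
begin

lemma hom_one: "\<tau> 1 = 1"
  and hom_add: "x \<in> F \<Longrightarrow> y \<in> F \<Longrightarrow> \<tau> (x + y) = \<tau> x + \<tau> y"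
  and hom_mult: "x \<in> F \<Longrightarrow> y \<in> F \<Longrightarrow> \<tau> (x * y) = \<tau> x * \<tau> y"
  using hom by (auto simp: field_hom_on_def)

lemma hom_zero: "\<tau> 0 = 0"
  using hom_add[of 0 0] subfield_zero[OF F] by simp

lemma hom_uminus: "x \<in> F \<Longrightarrow> \<tau> (- x) = - \<tau> x"
  using hom_add[of x "- x"] subfield_uminus[OF F] by (simp add: hom_zero add_eq_0_iff)

lemma hom_of_nat: "\<tau> (of_nat n) = of_nat n"
  by (induction n) (simp_all add: hom_zero hom_add hom_one subfield_one subfield_of_nat F)

lemma hom_of_int: "\<tau> (of_int n) = of_int n"
  by (cases n) (simp_all add: hom_of_nat hom_uminus subfield_of_nat F del: of_nat_Suc)

lemma hom_of_rat: "\<tau> (of_rat q) = of_rat q"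
proof (cases q)
  case (Fract a b)
  then have eq: "of_rat q * of_int b = (of_int a :: complex)" by (simp add: of_rat_rat)
  then have "\<tau> (of_rat q) * \<tau> (of_int b) = \<tau> (of_int a)"
    by (metis hom_mult subfield_of_rat[OF F] subfield_of_int[OF F])
  then have "\<tau> (of_rat q) * of_int b = of_rat q * of_int b" by (simp add: hom_of_int eq)
  then show ?thesis using Fract by simp
qed

lemma hom_rat_scale: "x \<in> F \<Longrightarrow> \<tau> (rat_scale q x) = rat_scale q (\<tau> x)"
  by (simp add: rat_scale_def hom_mult hom_of_rat subfield_of_rat F)

lemma hom_sum: "(\<And>i. i \<in> A \<Longrightarrow> f i \<in> F) \<Longrightarrow> \<tau> (sum f A) = (\<Sum>i\<in>A. \<tau> (f i))"
  by (induction A rule: infinite_finite_induct) (simp_all add: hom_zero hom_add subfield_sum F)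

lemma hom_prod:
  assumes "\<And>i. i \<in> A \<Longrightarrow> f i \<in> F"
  shows "\<tau> (prod f A) = (\<Prod>i\<in>A. \<tau> (f i)) \<and> prod f A \<in> F"
  using assms
  by (induction A rule: infinite_finite_induct)
    (simp_all add: hom_one hom_mult subfield_one subfield_mult F)

lemma hom_power: "x \<in> F \<Longrightarrow> \<tau> (x ^ n) = \<tau> x ^ n"
  by (induction n) (simp_all add: hom_one hom_mult subfield_power F)

lemma hom_nonzero: "x \<in> F \<Longrightarrow> x \<noteq> 0 \<Longrightarrow> \<tau> x \<noteq> 0"
  using hom_mult[of x "inverse x"] subfield_inverse[OF F] by (auto simp: hom_one)

lemma hom_inj: "x \<in> F \<Longrightarrow> y \<in> F \<Longrightarrow> \<tau> x = \<tau> y \<Longrightarrow> x = y"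
  using hom_nonzero[of "x - y"] hom_add[of x "- y"] subfield_add[OF F, of x "- y"]
    subfield_uminus[OF F, of y]
  by (auto simp: hom_uminus)

end

text \<open>Artin's argument: subtracting \<open>\<rho> y\<close> times the relation at
  \<open>x\<close> from the relation at \<open>x * y\<close> removes \<rho>, while the coefficient
  of \<tau> is multiplied by \<open>\<tau> y - \<rho> y\<close>.\<close>

lemma embeddings_linearly_independent:
  assumes F: "complex_subfield F" and "finite T" and "T \<subseteq> embeddings F"
    and "\<forall>x\<in>F. (\<Sum>\<tau>\<in>T. c \<tau> * \<tau> x) = 0"
  shows "\<forall>\<tau>\<in>T. c \<tau> = 0"
  using assms(2-)
proof (induction T arbitrary: c rule: finite_induct)
  case empty
  show ?case by simp
next
  case (insert \<rho> T)
  have hom: "field_hom_on F \<tau>" "\<tau> \<in> extensional F" if "\<tau> \<in> insert \<rho> T" for \<tau>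
    using insert.prems(1) that by (auto simp: mem_embeddings_iff)
  have zero: "c \<tau> = 0" if \<tau>: "\<tau> \<in> T" for \<tau>
  proof -
    \<comment> \<open>Extensionality ensures that distinct embeddings differ at a point of
      \<open>F\<close> itself.\<close>
    obtain y where y: "y \<in> F" "\<tau> y \<noteq> \<rho> y"
      using hom[of \<tau>] hom[of \<rho>] \<tau> insert.hyps(2) by (metis extensionalityI insertCI)
    have "(\<Sum>\<tau>\<in>T. (c \<tau> * (\<tau> y - \<rho> y)) * \<tau> x) = 0" if x: "x \<in> F" for x
    proof -
      have xy: "x * y \<in> F" using F x y(1) by (rule subfield_mult)
      have "0 = (\<Sum>\<tau>\<in>insert \<rho> T. c \<tau> * \<tau> (x * y)) - \<rho> y * (\<Sum>\<tau>\<in>insert \<rho> T. c \<tau> * \<tau> x)"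
        using bspec[OF insert.prems(2) x] bspec[OF insert.prems(2) xy] by simp
      also have "\<dots> = (\<Sum>\<tau>\<in>insert \<rho> T. c \<tau> * \<tau> (x * y) - \<rho> y * (c \<tau> * \<tau> x))"
        by (simp add: sum_subtractf sum_distrib_left)
      also have "\<dots> = (\<Sum>\<tau>\<in>insert \<rho> T. (c \<tau> * (\<tau> y - \<rho> y)) * \<tau> x)"
        using hom x y by (intro sum.cong) (auto simp: hom_mult[OF F] algebra_simps)
      also have "\<dots> = (\<Sum>\<tau>\<in>T. (c \<tau> * (\<tau> y - \<rho> y)) * \<tau> x)"
        using insert.hyps by simp
      finally show ?thesis by simp
    qed
    then have "c \<tau> * (\<tau> y - \<rho> y) = 0"
      using insert.IH[of "\<lambda>\<tau>. c \<tau> * (\<tau> y - \<rho> y)"] insert.prems(1) \<tau> by blast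
    then show ?thesis using y by simp
  qed
  have "c \<rho> = 0"
    using bspec[OF insert.prems(2) subfield_one[OF F]] insert.hyps zero hom_one[OF F hom(1)[of \<rho>]]
    by simp
  then show ?case using zero by blast
qed

text \<open>Zero rows make the system square; row \<open>s\<close> vanishes, so the determinant is
  0.\<close>

lemma homogeneous_system_nontrivial_solution:
  fixes A :: "nat \<Rightarrow> nat \<Rightarrow> 'a :: field"
  assumes "s < n"
  obtains v where "\<exists>i<n. v i \<noteq> 0" and "\<And>j. j < s \<Longrightarrow> (\<Sum>i<n. v i * A i j) = 0"
proof -
  define M where "M = mat n n (\<lambda>(j, i). if j < s then A i j else 0)"
  have M: "M \<in> carrier_mat n n" by (simp add: M_def)
  have "transpose_mat M *\<^sub>v unit_vec n s = 0\<^sub>v n"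
    using assms by (intro eq_vecI) (auto simp: M_def row_def)
  then have "det (transpose_mat M) = 0"
    using M assms by (subst det_0_iff_vec_prod_zero[of _ n]) (auto intro!: exI[of _ "unit_vec n s"])
  then have "det M = 0" using M by (simp add: det_transpose)
  then obtain w where w: "w \<in> carrier_vec n" "w \<noteq> 0\<^sub>v n" "M *\<^sub>v w = 0\<^sub>v n"
    using M by (subst (asm) det_0_iff_vec_prod_zero[of _ n]) auto
  show ?thesis
  proof (rule that)
    show "\<exists>i<n. w $ i \<noteq> 0" using w(1,2) by (metis carrier_vecD eq_vecI index_zero_vec)
    fix j assume j: "j < s"
    then have "(M *\<^sub>v w) $ j = 0" using w(3) assms by simp
    then show "(\<Sum>i<n. w $ i * A i j) = 0"
      using j assms w(1) by (simp add: M_def scalar_prod_def atLeast0LessThan mult.commute)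
  qed
qed

text \<open>With more embeddings than basis vectors there is a nontrivial relation on a rational
  basis; by linearity it holds on all of \<open>F\<close>, against independence. Positive degree
  makes the basis finite.\<close>

lemma card_embeddings_le_degree:
  assumes F: "complex_subfield F" and deg: "field_degree F > 0"
  shows "finite (embeddings F) \<and> card (embeddings F) \<le> field_degree F"
proof (rule finite_if_finite_subsets_card_bdd)
  fix T assume T: "T \<subseteq> embeddings F" "finite T"
  define s where "s = field_degree F"
  obtain B where B: "B \<subseteq> F" "F \<subseteq> ratvs.span B" "card B = s"
    using ratvs.basis_exists[of F] unfolding s_def field_degree_def by metis
  then have "finite B" using deg by (metis s_def card_gt_0_iff)
  then obtain b where b: "b ` {..<s} = B"
    using ex_bij_betw_nat_finite[of B] B(3) by (metis atLeast0LessThan bij_betw_imp_surj_on)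
  obtain h where h: "bij_betw h {..<card T} T"
    using ex_bij_betw_nat_finite[OF T(2)] by (metis atLeast0LessThan)
  show "card T \<le> field_degree F"
  proof (rule ccontr)
    assume "\<not> card T \<le> field_degree F"
    then have "s < card T" by (simp add: s_def)
    then obtain w where w: "\<exists>i<card T. w i \<noteq> 0"
      "\<And>j. j < s \<Longrightarrow> (\<Sum>i<card T. w i * h i (b j)) = 0"
      using homogeneous_system_nontrivial_solution[of s "card T" "\<lambda>i j. h i (b j)"] by metis
    define c where "c \<tau> = w (the_inv_into {..<card T} h \<tau>)" for \<tau>
    have c: "c (h i) = w i" if "i < card T" for i
      using that h by (simp add: c_def bij_betw_def the_inv_into_f_f)
    have sum_T: "(\<Sum>\<tau>\<in>T. c \<tau> * \<tau> x) = (\<Sum>i<card T. w i * h i x)" for x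
      using sum.reindex_bij_betw[OF h, of "\<lambda>\<tau>. c \<tau> * \<tau> x"] c by simp
    define S where "S = {x \<in> F. (\<Sum>\<tau>\<in>T. c \<tau> * \<tau> x) = 0}"
    have hom: "field_hom_on F \<tau>" if "\<tau> \<in> T" for \<tau>
      using that T by (auto simp: mem_embeddings_iff)
    have "ratvs.subspace S"
      unfolding ratvs.subspace_def
    proof (intro conjI ballI allI)
      show "0 \<in> S" using subfield_zero[OF F] hom_zero[OF F hom] by (auto simp: S_def intro!: sum.neutral)
      show "x + y \<in> S" if "x \<in> S" "y \<in> S" for x y
      proof -
        have "(\<Sum>\<tau>\<in>T. c \<tau> * \<tau> (x + y)) = (\<Sum>\<tau>\<in>T. c \<tau> * \<tau> x + c \<tau> * \<tau> y)"
          using that hom by (intro sum.cong) (auto simp: S_def hom_add[OF F] distrib_left)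
        then show ?thesis
          using that subfield_add[OF F] by (simp add: S_def sum.distrib)
      qed
      show "rat_scale q x \<in> S" if x: "x \<in> S" for q x
      proof -
        have "(\<Sum>\<tau>\<in>T. c \<tau> * \<tau> (rat_scale q x)) = of_rat q * (\<Sum>\<tau>\<in>T. c \<tau> * \<tau> x)"
          using x hom_rat_scale[OF F hom] unfolding sum_distrib_left
          by (intro sum.cong) (auto simp: S_def rat_scale_def)
        then show ?thesis
          using x subfield_mult[OF F subfield_of_rat[OF F]] by (simp add: S_def rat_scale_def)
      qed
    qed
    moreover have "B \<subseteq> S" using B(1) b w(2) by (auto simp: S_def sum_T)
    ultimately have "F \<subseteq> S" using B(2) ratvs.span_minimal by blast
    then have "c \<tau> = 0" if "\<tau> \<in> T" for \<tau>
      using embeddings_linearly_independent[OF F T(2,1), of c] that by (auto simp: S_def)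
    then show False using w(1) c h by (metis bij_betwE lessThan_iff)
  qed
qed

section \<open>Conjugates in the cyclotomic field\<close>

locale cyclotomic =
  fixes p v :: nat and \<zeta> :: complex and L :: "complex set" and \<sigma> :: "complex \<Rightarrow> complex"
  assumes prime_p: "prime p"
    and zeta: "primitive_root_of_unity p \<zeta>"
    and L_def: "L = rat_adjoin \<zeta>"
    and coprime_v: "coprime v p"
    and v_generates: "\<And>c. coprime c p \<Longrightarrow> \<exists>k. [v ^ k = c] (mod p)"
    and sigma_hom: "field_hom_on L \<sigma>" and sigma_L: "\<sigma> ` L \<subseteq> L"
    and sigma_zeta: "\<sigma> \<zeta> = \<zeta> ^ v"
begin

lemma p_gt_1: "p > 1" and p_gt_0: "p > 0"
  using prime_gt_1_nat[OF prime_p] by auto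

lemma zeta_p: "\<zeta> ^ p = 1" and zeta_nonzero: "\<zeta> \<noteq> 0"
  using zeta p_gt_0 by (auto simp: primitive_root_of_unity_def power_0_left)

lemma zeta_pow_mod: "\<zeta> ^ (k mod p) = \<zeta> ^ k"
proof -
  have "\<zeta> ^ k = (\<zeta> ^ p) ^ (k div p) * \<zeta> ^ (k mod p)"
    by (metis mult_div_mod_eq power_add power_mult)
  then show ?thesis by (simp add: zeta_p)
qed

lemma zeta_pow_eq_1_iff: "\<zeta> ^ k = 1 \<longleftrightarrow> p dvd k"
proof
  assume "\<zeta> ^ k = 1"
  then have "\<zeta> ^ (k mod p) = 1" by (simp add: zeta_pow_mod)
  then show "p dvd k"
    using zeta mod_less_divisor[OF p_gt_0, of k]
    unfolding primitive_root_of_unity_def by (metis dvd_eq_mod_eq_0 gr0I)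
next
  assume "p dvd k"
  then show "\<zeta> ^ k = 1" by (metis dvd_eq_mod_eq_0 power_0 zeta_pow_mod)
qed

lemma zeta_pow_eq_iff: "\<zeta> ^ a = \<zeta> ^ b \<longleftrightarrow> [a = b] (mod p)"
proof -
  have *: "\<zeta> ^ a = \<zeta> ^ b \<longleftrightarrow> [a = b] (mod p)" if "a \<le> b" for a b
  proof -
    have "\<zeta> ^ b = \<zeta> ^ a * \<zeta> ^ (b - a)" using that by (simp flip: power_add)
    then have "\<zeta> ^ a = \<zeta> ^ b \<longleftrightarrow> p dvd b - a"
      using zeta_nonzero by (simp flip: zeta_pow_eq_1_iff)
    then show ?thesis using that by (metis cong_altdef_nat cong_sym_eq)
  qed
  show ?thesis using *[of a b] *[of b a] by (metis cong_sym_eq linear)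
qed

lemma roots_of_unity: "x ^ p = 1 \<Longrightarrow> \<exists>k<p. x = \<zeta> ^ k"
proof -
  assume x: "x ^ p = 1"
  have "inj_on (\<lambda>k. \<zeta> ^ k) {..<p}"
    by (auto simp: inj_on_def zeta_pow_eq_iff cong_def)
  then have "card ((\<lambda>k. \<zeta> ^ k) ` {..<p}) = p" by (simp add: card_image)
  moreover have "card {z :: complex. z ^ p = 1} = p"
    using card_nth_roots[of 1 p] p_gt_0 by simp
  moreover have "(\<zeta> ^ k) ^ p = 1" for k
    by (metis mult.commute power_mult power_one zeta_p)
  moreover have "finite {z :: complex. z ^ p = 1}"
    using finite_nth_roots[of p 1] p_gt_0 by simp
  ultimately have "(\<lambda>k. \<zeta> ^ k) ` {..<p} = {z. z ^ p = 1}"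
    by (intro card_subset_eq) auto
  then show ?thesis using x by blast
qed

lemma cnj_zeta: "cnj \<zeta> = \<zeta> ^ (p - 1)"
proof -
  have "\<zeta> * \<zeta> ^ (p - 1) = 1" using p_gt_0 zeta_p by (metis power_minus_mult mult.commute)
  moreover have "norm \<zeta> = 1"
    using power_eq_imp_eq_base[of "norm \<zeta>" p 1] zeta_p p_gt_0 by (simp flip: norm_power)
  then have "\<zeta> * cnj \<zeta> = 1" using complex_norm_square[of \<zeta>] by simp
  ultimately show ?thesis using zeta_nonzero by (metis mult_cancel_left)
qed

lemma ord_v: "ord p v = p - 1"
proof (rule antisym)
  have "ord p v dvd totient p"
    using coprime_v by (intro order_divides_totient) (simp add: coprime_commute)
  then show "ord p v \<le> p - 1"
    using prime_p p_gt_1 by (simp add: totient_prime dvd_imp_le)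
  have ord0: "ord p v > 0" using coprime_v by (simp add: ord_eq_0 coprime_commute flip: neq0_conv)
  have "{1..<p} \<subseteq> (\<lambda>k. v ^ k mod p) ` {..<ord p v}"
  proof
    fix c assume c: "c \<in> {1..<p}"
    then have "coprime c p"
      using prime_p by (metis atLeastLessThan_iff coprime_commute less_one not_less
          prime_imp_coprime nat_dvd_not_less zero_less_iff_neq_zero)
    then obtain k where "[v ^ k = c] (mod p)" using v_generates by blast
    moreover have "[v ^ k = v ^ (k mod ord p v)] (mod p)"
      using coprime_v by (subst order_divides_expdiff) (auto simp: coprime_commute cong_def)
    ultimately have "v ^ (k mod ord p v) mod p = c" using c by (simp add: cong_def)
    then show "c \<in> (\<lambda>k. v ^ k mod p) ` {..<ord p v}"
      using ord0 by (metis imageI lessThan_iff mod_less_divisor)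
  qed
  from card_mono[OF _ this] card_image_le[of "{..<ord p v}" "\<lambda>k. v ^ k mod p"]
  show "p - 1 \<le> ord p v" by simp
qed

lemma v_pow_eq_iff: "[v ^ i = v ^ j] (mod p) \<longleftrightarrow> [i = j] (mod p - 1)"
  using order_divides_expdiff[of p v i j] coprime_v by (simp add: ord_v coprime_commute)

lemma bij_betw_v_pow: "bij_betw (\<lambda>k. v ^ k mod p) {..<p - 1} {1..<p}"
proof -
  have inj: "inj_on (\<lambda>k. v ^ k mod p) {..<p - 1}"
    using v_pow_eq_iff by (auto simp: inj_on_def cong_def)
  moreover have "(\<lambda>k. v ^ k mod p) ` {..<p - 1} \<subseteq> {1..<p}"
  proof -
    have "v ^ k mod p \<noteq> 0" for k
      using coprime_v prime_p p_gt_1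
      by (metis coprime_absorb_right coprime_commute coprime_power_right_iff dvd_eq_mod_eq_0
          nat_dvd_1_iff_1 nat_neq_iff coprime_power_left_iff is_unit_power_iff)
    then show ?thesis using p_gt_0 by (auto simp: Suc_le_eq)
  qed
  ultimately have "(\<lambda>k. v ^ k mod p) ` {..<p - 1} = {1..<p}"
    by (intro card_subset_eq) (auto simp: card_image)
  then show ?thesis using inj by (simp add: bij_betw_def)
qed

text \<open>Numbers the nontrivial \<open>p\<close>-th roots of unity along the cyclic unit group,
  so that \<sigma> becomes the shift by one and indices count modulo \<open>p - 1\<close>.\<close>

definition g :: "nat \<Rightarrow> complex" where
  "g k = \<zeta> ^ (v ^ k)"

lemma g_eq_iff: "g i = g j \<longleftrightarrow> [i = j] (mod p - 1)"
  by (simp add: g_def zeta_pow_eq_iff v_pow_eq_iff)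

lemma g_periodic: "g (k + (p - 1) * n) = g k"
  by (simp add: g_eq_iff cong_def)

lemma zeta_pow_cases: obtains "p dvd k" | j where "\<zeta> ^ k = g j"
proof (cases "p dvd k")
  case False
  then have "coprime k p" using prime_p by (metis coprime_commute prime_imp_coprime)
  then obtain j where "[v ^ j = k] (mod p)" using v_generates by blast
  then have "\<zeta> ^ k = g j" by (metis g_def zeta_pow_eq_iff)
  then show ?thesis by (rule that(2))
qed (rule that(1))

text \<open>The absolute trace of \<open>\<zeta> ^ n\<close>: since \<open>v ^ k\<close> runs
  through the nonzero residues, it is a complete geometric sum without its term 1.\<close>

lemma sum_zeta_pow_v:
  "(\<Sum>k<p - 1. \<zeta> ^ (v ^ k * n)) = (if p dvd n then of_nat p - 1 else - 1)"
proof -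
  have "(\<Sum>k<p - 1. \<zeta> ^ (v ^ k * n)) = (\<Sum>k<p - 1. (\<zeta> ^ n) ^ (v ^ k mod p))"
  proof (rule sum.cong)
    fix k
    have "\<zeta> ^ (v ^ k * n) = \<zeta> ^ (n * (v ^ k mod p))"
      unfolding zeta_pow_eq_iff by (simp add: cong_def mod_simps mult.commute)
    then show "\<zeta> ^ (v ^ k * n) = (\<zeta> ^ n) ^ (v ^ k mod p)" by (simp add: power_mult)
  qed simp
  also have "\<dots> = (\<Sum>m=1..<p. (\<zeta> ^ n) ^ m)"
    by (rule sum.reindex_bij_betw[OF bij_betw_v_pow])
  also have "\<dots> = (\<Sum>m<p. (\<zeta> ^ n) ^ m) - 1"
    using p_gt_0 by (simp add: lessThan_atLeast0 sum.atLeast_Suc_lessThan)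
  also have "\<dots> = (if p dvd n then of_nat p - 1 else - 1)"
  proof (cases "p dvd n")
    case True
    then show ?thesis by (simp add: zeta_pow_eq_1_iff[THEN iffD2])
  next
    case False
    then have "\<zeta> ^ n \<noteq> 1" by (simp add: zeta_pow_eq_1_iff)
    moreover have "(\<zeta> ^ n) ^ p = 1" by (metis mult.commute power_mult power_one zeta_p)
    ultimately have "(\<Sum>m<p. (\<zeta> ^ n) ^ m) = 0" by (simp add: geometric_sum)
    then show ?thesis using False by simp
  qed
  finally show ?thesis .
qed

lemma sum_g: "(\<Sum>k<p - 1. g k) = - 1"
  using sum_zeta_pow_v[of 1] p_gt_1 by (simp add: g_def)

section \<open>The action of \<sigma> on the cyclotomic field\<close>

lemma subfield_L: "complex_subfield L"
  unfolding L_def rat_adjoin_def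
  by (rule hull_in) (auto simp: complex_subfield_def)

lemma zeta_in_L: "\<zeta> \<in> L"
  unfolding L_def rat_adjoin_def by (meson hull_subset insert_subset)

lemma g_in_L: "g k \<in> L"
  unfolding g_def by (intro subfield_power subfield_L zeta_in_L)

lemma sigma_pow_hom: "field_hom_on L (\<sigma> ^^ k) \<and> (\<sigma> ^^ k) ` L \<subseteq> L"
proof (induction k)
  case 0
  then show ?case by (simp add: field_hom_on_def)
next
  case (Suc k)
  then show ?case
    using field_hom_on_comp[of L "\<sigma> ^^ k" L \<sigma>] sigma_hom sigma_L by (auto simp: o_def image_subset_iff)
qed

lemmas sigma_pow_on_L = sigma_pow_hom[THEN conjunct1]

lemma sigma_pow_in_L: "x \<in> L \<Longrightarrow> (\<sigma> ^^ k) x \<in> L"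
  using sigma_pow_hom by blast

lemma sigma_g: "\<sigma> (g k) = g (Suc k)"
proof -
  have "\<sigma> (g k) = (\<zeta> ^ v) ^ (v ^ k)"
    using hom_power[OF subfield_L sigma_hom zeta_in_L] by (simp add: g_def sigma_zeta)
  then show ?thesis by (simp add: g_def power_mult)
qed

lemma sigma_pow_g: "(\<sigma> ^^ j) (g k) = g (j + k)"
  by (induction j) (simp_all add: sigma_g)

lemma g_0: "g 0 = \<zeta>"
  by (simp add: g_def)

text \<open>The Gaussian period of a coset of the subgroup generated by \<open>v ^ m\<close>. The
  parameter is left open to serve for \<open>m = 1\<close>, for the order of \<sigma> on a subfield,
  and for \<open>s\<close>.\<close>

definition period :: "nat \<Rightarrow> nat \<Rightarrow> complex" where
  "period m i = (\<Sum>l<(p - 1) div m. g (m * l + i))"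

lemma period_in_L: "period m i \<in> L"
  unfolding period_def by (intro subfield_sum subfield_L g_in_L)

lemma sigma_pow_period: "(\<sigma> ^^ j) (period m i) = period m (j + i)"
  unfolding period_def
  by (subst hom_sum[OF subfield_L sigma_pow_on_L]) (simp_all add: g_in_L sigma_pow_g ac_simps)

text \<open>Shifting by \<open>m\<close> drops the first summand and appends one whose index is
  larger by \<open>p - 1\<close>, which is the same root.\<close>

lemma period_add:
  assumes "m dvd p - 1"
  shows "period m (i + m * n) = period m i"
proof -
  define c where "c = (p - 1) div m"
  have step: "period m (i + m) = period m i" for i
  proof -
    have "period m (i + m) = (\<Sum>l<c. g (m * Suc l + i))"
      by (simp add: period_def c_def ac_simps)
    also have "\<dots> = (\<Sum>l<Suc c. g (m * l + i)) - g i"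
      by (subst sum.lessThan_Suc_shift) simp
    also have "\<dots> = (\<Sum>l<c. g (m * l + i)) + g (m * c + i) - g i" by simp
    also have "m * c = p - 1" using assms by (simp add: c_def)
    also have "g (p - 1 + i) = g i" using g_periodic[of i 1] by (simp add: add.commute)
    finally show ?thesis by (simp add: period_def c_def)
  qed
  show ?thesis
  proof (induction n)
    case (Suc n)
    then show ?case using step[of "i + m * n"] by (simp add: ac_simps)
  qed simp
qed

lemma period_mod: "m dvd p - 1 \<Longrightarrow> period m (i mod m) = period m i"
  using period_add[of m "i mod m" "i div m"] by simp

text \<open>The periods together collect all nontrivial roots of unity. The result makes rational
  numbers combinations of periods.\<close>

lemma sum_period:
  assumes "m dvd p - 1"
  shows "(\<Sum>i<m. period m i) = - 1"
proof -
  have "(\<Sum>i<m. period m i) = (\<Sum>l<(p - 1) div m. \<Sum>i<m. g (m * l + i))"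
    unfolding period_def by (rule sum.swap)
  also have "\<dots> = (\<Sum>l<(p - 1) div m. sum g {l * m..<l * m + m})"
  proof (rule sum.cong)
    fix l
    show "(\<Sum>i<m. g (m * l + i)) = sum g {l * m..<l * m + m}"
      using sum.shift_bounds_nat_ivl[of g 0 "l * m" m]
      by (simp add: lessThan_atLeast0 ac_simps)
  qed simp
  also have "\<dots> = sum g {..<(p - 1) div m * m}" by (rule sum.nat_group)
  also have "\<dots> = - 1" using assms sum_g by simp
  finally show ?thesis .
qed

text \<open>Q[\<zeta>] as a rational vector space, generated by all powers without choosing a basis.
  Once it is known to be \<open>L\<close>, linear statements about \<open>L\<close> can be checked
  on powers of \<zeta>.\<close>

definition zeta_span :: "complex set" where
  "zeta_span = ratvs.span (range (\<lambda>k. \<zeta> ^ k))"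

lemma zeta_span_subset: "zeta_span \<subseteq> L"
  unfolding zeta_span_def
  by (rule ratvs.span_minimal) (auto intro: subfield_subspace subfield_power subfield_L zeta_in_L)

lemma zeta_pow_in_span: "\<zeta> ^ k \<in> zeta_span"
  unfolding zeta_span_def by (auto intro: ratvs.span_base)

lemma subspace_zeta_span: "ratvs.subspace zeta_span"
  by (simp add: zeta_span_def)

lemma zeta_span_induct [consumes 1, case_names subspace pow]:
  assumes "x \<in> zeta_span" and "ratvs.subspace {x. P x}" and "\<And>k. P (\<zeta> ^ k)"
  shows "P x"
  using ratvs.span_induct[of x "range (\<lambda>k. \<zeta> ^ k)" P] assms by (auto simp: zeta_span_def)

lemma rat_scale_mult: "rat_scale q x * y = rat_scale q (x * y)" "y * rat_scale q x = rat_scale q (y * x)"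
  by (simp_all add: rat_scale_def)

lemma zeta_span_mult:
  assumes x: "x \<in> zeta_span" and y: "y \<in> zeta_span"
  shows "x * y \<in> zeta_span"
proof -
  note sub = ratvs.subspace_0[OF subspace_zeta_span] ratvs.subspace_add[OF subspace_zeta_span]
    ratvs.subspace_scale[OF subspace_zeta_span]
  have *: "\<zeta> ^ k * y \<in> zeta_span" for k
    using y
  proof (induction y rule: zeta_span_induct)
    case subspace
    then show ?case using sub by (auto simp: ratvs.subspace_def distrib_left rat_scale_mult)
  next
    case (pow j)
    then show ?case using zeta_pow_in_span[of "k + j"] by (simp add: power_add)
  qed
  show ?thesis
    using x
  proof (induction x rule: zeta_span_induct)
    case subspace
    then show ?case using sub by (auto simp: ratvs.subspace_def distrib_right rat_scale_mult)
  qed (rule *)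
qed

lemma subspace_fixed:
  assumes "field_hom_on L \<tau>" and "field_hom_on L \<rho>"
  shows "ratvs.subspace {x \<in> L. \<tau> x = \<rho> x}"
  using subfield_subspace[OF subfield_L]
    assms[THEN hom_zero[OF subfield_L]] assms[THEN hom_add[OF subfield_L]]
    assms[THEN hom_rat_scale[OF subfield_L]]
  by (auto simp: ratvs.subspace_def)

lemma sigma_pow_zeta_span:
  assumes "x \<in> zeta_span"
  shows "(\<sigma> ^^ k) x \<in> zeta_span"
proof -
  \<comment> \<open>Membership in \<open>L\<close> is carried along because the homomorphism laws
    hold only there.\<close>
  have "x \<in> L \<and> (\<sigma> ^^ k) x \<in> zeta_span"
    using assms
  proof (induction x rule: zeta_span_induct)
    case subspace
    then show ?case
      using subfield_subspace[OF subfield_L] subspace_zeta_span hom_zero[OF subfield_L sigma_pow_on_L]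
        hom_add[OF subfield_L sigma_pow_on_L] hom_rat_scale[OF subfield_L sigma_pow_on_L]
      by (auto simp: ratvs.subspace_def)
  next
    case (pow j)
    have "(\<sigma> ^^ k) (\<zeta> ^ j) = \<zeta> ^ (v ^ k * j)"
      using hom_power[OF subfield_L sigma_pow_on_L zeta_in_L, of k j] sigma_pow_g[of k 0]
      by (simp add: g_0) (simp add: g_def power_mult)
    then show ?case using zeta_pow_in_span subfield_power[OF subfield_L zeta_in_L] by simp
  qed
  then show ?thesis by simp
qed

lemma homs_eq_on_zeta_span:
  assumes "field_hom_on L \<tau>" and "field_hom_on L \<rho>" and "\<tau> \<zeta> = \<rho> \<zeta>" and "x \<in> zeta_span"
  shows "\<tau> x = \<rho> x"
proof -
  have "x \<in> L \<and> \<tau> x = \<rho> x"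
    using assms(4)
  proof (induction x rule: zeta_span_induct)
    case subspace
    then show ?case using subspace_fixed[OF assms(1,2)] by simp
  next
    case (pow k)
    then show ?case
      using hom_power[OF subfield_L assms(1) zeta_in_L] hom_power[OF subfield_L assms(2) zeta_in_L]
      by (simp add: assms(3) subfield_power subfield_L zeta_in_L)
  qed
  then show ?thesis by simp
qed

text \<open>This is the trace to the field fixed by \<open>\<sigma> ^^ m\<close>. It sends a
  nontrivial power of \<zeta> to a period, and 1 to an integer, which is a multiple of the sum of
  all periods.\<close>

lemma trace_in_period_span:
  assumes m: "m dvd p - 1" "m > 0" and x: "x \<in> zeta_span"
  shows "(\<Sum>l<(p - 1) div m. (\<sigma> ^^ (m * l)) x) \<in> ratvs.span (period m ` {..<m})"
proof -
  let ?S = "ratvs.span (period m ` {..<m})" and ?c = "(p - 1) div m"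
  have per: "period m i \<in> ?S" for i
    using m by (subst period_mod[symmetric]) (auto intro!: ratvs.span_base)
  have "x \<in> L \<and> (\<Sum>l<?c. (\<sigma> ^^ (m * l)) x) \<in> ?S"
    using x
  proof (induction x rule: zeta_span_induct)
    case subspace
    have "(\<Sum>l<?c. (\<sigma> ^^ (m * l)) (rat_scale q x)) = rat_scale q (\<Sum>l<?c. (\<sigma> ^^ (m * l)) x)"
      if "x \<in> L" for q x
      using that by (simp add: hom_rat_scale[OF subfield_L sigma_pow_on_L] ratvs.scale_sum_right)
    then show ?case
      using subfield_subspace[OF subfield_L] hom_zero[OF subfield_L sigma_pow_on_L]
        hom_add[OF subfield_L sigma_pow_on_L]
      by (auto simp: ratvs.subspace_def sum.distrib ratvs.span_zero ratvs.span_add ratvs.span_scale)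
  next
    case (pow k)
    show ?case
    proof (cases rule: zeta_pow_cases[of k])
      case 1
      then have 1: "\<zeta> ^ k = 1" by (simp add: zeta_pow_eq_1_iff)
      have "(\<Sum>l<?c. (\<sigma> ^^ (m * l)) (\<zeta> ^ k)) = of_nat ?c"
        unfolding 1 by (simp add: hom_one[OF subfield_L sigma_pow_on_L])
      also have "\<dots> = rat_scale (- of_nat ?c) (\<Sum>i<m. period m i)"
        unfolding sum_period[OF m(1)] by (simp add: rat_scale_def of_rat_minus)
      also have "\<dots> \<in> ?S" by (intro ratvs.span_scale ratvs.span_sum per)
      finally show ?thesis using subfield_power[OF subfield_L zeta_in_L] by simp
    next
      case (2 j)
      have "(\<Sum>l<?c. (\<sigma> ^^ (m * l)) (\<zeta> ^ k)) = period m j"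
        by (simp add: 2 sigma_pow_g period_def)
      then show ?thesis using per subfield_power[OF subfield_L zeta_in_L] by simp
    qed
  qed
  then show ?thesis by simp
qed

text \<open>On a fixed element the trace is multiplication by \<open>(p - 1) div m\<close>, which
  can be divided out over the rationals.\<close>

lemma fixed_in_period_span:
  assumes m: "m dvd p - 1" "m > 0" and x: "x \<in> zeta_span" and fixed: "(\<sigma> ^^ m) x = x"
  shows "x \<in> ratvs.span (period m ` {..<m})"
proof -
  let ?c = "(p - 1) div m"
  have "(\<sigma> ^^ (m * l)) x = x" for l
    by (induction l) (simp_all add: funpow_add fixed)
  then have "of_nat ?c * x \<in> ratvs.span (period m ` {..<m})"
    using trace_in_period_span[OF m x] by simp
  moreover have "?c \<noteq> 0" using m p_gt_1 by (auto simp: dvd_div_eq_0_iff)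
  then have "x = rat_scale (1 / of_nat ?c) (of_nat ?c * x)"
    by (simp add: rat_scale_def of_rat_divide)
  ultimately show ?thesis using ratvs.span_scale by metis
qed

lemma sigma_period_id:
  assumes "x \<in> zeta_span"
  shows "(\<sigma> ^^ (p - 1)) x = x"
proof -
  have "(\<sigma> ^^ (p - 1)) \<zeta> = (\<sigma> ^^ 0) \<zeta>"
    using sigma_pow_g[of "p - 1" 0] g_periodic[of 0 1] by (simp add: g_0)
  from homs_eq_on_zeta_span[OF sigma_pow_on_L sigma_pow_on_L this assms] show ?thesis by simp
qed

text \<open>The inverse of \<open>x\<close> is the product of its other conjugates divided by its norm, which is
  fixed by \<open>\<sigma>\<close> and hence rational.\<close>

lemma zeta_span_inverse:
  assumes x: "x \<in> zeta_span"
  shows "inverse x \<in> zeta_span"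
proof (cases "x = 0")
  case True
  then show ?thesis using x by simp
next
  case False
  define N where "N = (\<Prod>k<p - 1. (\<sigma> ^^ k) x)"
  define R where "R = (\<Prod>k=1..<p - 1. (\<sigma> ^^ k) x)"
  have xL: "x \<in> L" using x zeta_span_subset by blast
  have one: "1 \<in> zeta_span" using zeta_pow_in_span[of 0] by simp
  have prod_in: "(\<Prod>k\<in>A. (\<sigma> ^^ k) x) \<in> zeta_span" for A
    by (induction A rule: infinite_finite_induct)
      (auto intro: one zeta_span_mult sigma_pow_zeta_span x)
  have "{..<p - 1} = insert 0 {1..<p - 1}" using p_gt_1 by auto
  then have NR: "N = x * R" by (simp add: N_def R_def)
  have "N \<noteq> 0"
    unfolding N_def using hom_nonzero[OF subfield_L sigma_pow_on_L xL False] by simp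
  have "\<sigma> N = (\<Prod>k<p - 1. (\<sigma> ^^ Suc k) x)"
    unfolding N_def
    using hom_prod[OF subfield_L sigma_hom, of "{..<p - 1}" "\<lambda>k. (\<sigma> ^^ k) x"] sigma_pow_in_L[OF xL]
    by simp
  \<comment> \<open>Shifting the product trades its factor \<open>x\<close> for
    \<open>(\<sigma> ^^ (p - 1)) x\<close>, which is \<open>x\<close> again.\<close>
  also have "\<dots> * (\<sigma> ^^ 0) x = N * (\<sigma> ^^ (p - 1)) x"
    unfolding N_def
    using prod.lessThan_Suc_shift[of "\<lambda>k. (\<sigma> ^^ k) x" "p - 1"] prod.lessThan_Suc[of "\<lambda>k. (\<sigma> ^^ k) x" "p - 1"]
    by (simp add: mult.commute)
  finally have "\<sigma> N = N" using False sigma_period_id[OF x] by simp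
  then have "N \<in> ratvs.span (period 1 ` {..<1})"
    using prod_in by (intro fixed_in_period_span) (auto simp: N_def)
  \<comment> \<open>For \<open>m = 1\<close> the only period is -1, so the span consists of the
    rationals.\<close>
  also have "period 1 ` {..<1} = {- 1}"
    using sum_period[of 1] by (simp add: lessThan_Suc)
  finally obtain q where q: "N = rat_scale q (- 1)"
    using ratvs.span_singleton[of "- 1"] by auto
  have "complex_of_rat q = - (x * R)"
    using NR q by (metis add.inverse_inverse mult.right_neutral mult_minus_right rat_scale_def)
  then have "inverse x = rat_scale (- inverse q) R"
    using NR \<open>N \<noteq> 0\<close> by (simp add: rat_scale_def of_rat_minus of_rat_inverse)
  moreover have "rat_scale (- inverse q) R \<in> zeta_span"
    unfolding R_def by (rule ratvs.subspace_scale[OF subspace_zeta_span prod_in])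
  ultimately show ?thesis by simp
qed

lemma L_eq_zeta_span: "L = zeta_span"
proof
  have "complex_subfield zeta_span"
    unfolding complex_subfield_def
    using ratvs.subspace_0[OF subspace_zeta_span] ratvs.subspace_add[OF subspace_zeta_span]
      ratvs.subspace_neg[OF subspace_zeta_span] zeta_span_mult zeta_span_inverse
      zeta_pow_in_span[of 0]
    by auto
  moreover have "{\<zeta>} \<subseteq> zeta_span" using zeta_pow_in_span[of 1] by simp
  ultimately show "L \<subseteq> zeta_span"
    unfolding L_def rat_adjoin_def by (meson hull_minimal)
qed (rule zeta_span_subset)

text \<open>The image of \<zeta> is a \<open>p\<close>-th root of unity, not 1 by injectivity, hence
  some \<open>g j\<close>; so the embedding agrees with a power of \<sigma> on \<zeta> and therefore
  on \<open>L\<close>.\<close>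

lemma embeddings_L: "embeddings L = (\<lambda>j. restrict (\<sigma> ^^ j) L) ` {..<p - 1}"
proof (intro equalityI subsetI)
  fix \<tau> assume \<tau>: "\<tau> \<in> embeddings L"
  then have hom: "field_hom_on L \<tau>" "\<tau> \<in> extensional L" by (auto simp: mem_embeddings_iff)
  have "\<tau> \<zeta> ^ p = 1"
    using hom_power[OF subfield_L hom(1) zeta_in_L, of p] hom_one[OF subfield_L hom(1)]
    by (simp add: zeta_p)
  then obtain k where k: "k < p" "\<tau> \<zeta> = \<zeta> ^ k" using roots_of_unity by blast
  have "\<not> p dvd k"
  proof
    assume "p dvd k"
    then have "\<tau> \<zeta> = \<tau> 1" using k(2) hom_one[OF subfield_L hom(1)] by (simp add: zeta_pow_eq_1_iff)
    then have "\<zeta> = 1" using hom_inj[OF subfield_L hom(1)] zeta_in_L subfield_one[OF subfield_L] by blast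
    then show False using zeta_pow_eq_1_iff[of 1] p_gt_1 by simp
  qed
  then obtain j where j: "\<zeta> ^ k = g j" using zeta_pow_cases[of k] by blast
  define i where "i = j mod (p - 1)"
  have "g j = g i" by (simp add: g_eq_iff i_def cong_def)
  then have "\<tau> \<zeta> = (\<sigma> ^^ i) \<zeta>" using sigma_pow_g[of i 0] by (simp add: k j g_0)
  from homs_eq_on_zeta_span[OF hom(1) sigma_pow_on_L this]
  have "\<tau> x = (\<sigma> ^^ i) x" if "x \<in> L" for x
    using that unfolding L_eq_zeta_span .
  then have "\<tau> = restrict (\<sigma> ^^ i) L" using hom(2)
    by (intro extensionalityI[of _ L]) auto
  moreover have "i < p - 1" using p_gt_1 by (simp add: i_def)
  ultimately show "\<tau> \<in> (\<lambda>j. restrict (\<sigma> ^^ j) L) ` {..<p - 1}" by blast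
qed (auto intro: restrict_mem_embeddings subfield_L sigma_pow_on_L)

text \<open>Conjugation raises \<zeta> to the power \<open>p - 1\<close>, which is prime to
  \<open>p\<close>. As a power of \<sigma> it commutes on \<open>L\<close> with all the
  others.\<close>

lemma cnj_eq_sigma_pow: "\<exists>h. \<forall>x\<in>L. cnj x = (\<sigma> ^^ h) x"
proof -
  have "\<not> p dvd p - 1" using p_gt_1 by (auto dest: dvd_imp_le)
  then obtain h where "\<zeta> ^ (p - 1) = g h" using zeta_pow_cases[of "p - 1"] by blast
  then have "cnj \<zeta> = (\<sigma> ^^ h) \<zeta>" using sigma_pow_g[of h 0] by (simp add: cnj_zeta g_0)
  moreover have "field_hom_on L cnj" by (simp add: field_hom_on_def)
  ultimately have "cnj x = (\<sigma> ^^ h) x" if "x \<in> L" for x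
    using homs_eq_on_zeta_span[OF _ sigma_pow_on_L] that unfolding L_eq_zeta_span by blast
  then show ?thesis by blast
qed

end

section \<open>Gaussian periods\<close>

locale cyclotomic_subfield = cyclotomic +
  fixes K :: "complex set" and s :: nat
  assumes subfield_K: "complex_subfield K" and K_sub_L: "K \<subseteq> L"
    and degree_K: "field_degree K = s" and s_pos: "s > 0"
begin

text \<open>The exponents fixing \<open>K\<close> are closed under remainders, so they are the
  multiples of the least positive one; \<open>p - 1\<close> shows that one exists.\<close>

lemma fixing_exponents:
  "\<exists>m>0. \<forall>k. (\<forall>x\<in>K. (\<sigma> ^^ k) x = x) \<longleftrightarrow> m dvd k"
proof -
  define P where "P k \<longleftrightarrow> k > 0 \<and> (\<forall>x\<in>K. (\<sigma> ^^ k) x = x)" for k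
  define m where "m = (LEAST k. P k)"
  have "P (p - 1)"
    using K_sub_L sigma_period_id p_gt_1 unfolding P_def L_eq_zeta_span by auto
  then have m: "P m" unfolding m_def by (rule LeastI)
  have mult: "(\<sigma> ^^ (m * q)) x = x" if "x \<in> K" for q x
    using m that by (induction q) (simp_all add: P_def funpow_add)
  have "(\<forall>x\<in>K. (\<sigma> ^^ k) x = x) \<longleftrightarrow> m dvd k" for k
  proof
    assume *: "\<forall>x\<in>K. (\<sigma> ^^ k) x = x"
    have "(\<sigma> ^^ (k mod m)) x = x" if "x \<in> K" for x
    proof -
      have "(\<sigma> ^^ k) x = (\<sigma> ^^ (k mod m)) ((\<sigma> ^^ (m * (k div m))) x)"
        by (metis comp_apply funpow_add mod_mult_div_eq)
      then show ?thesis using that * mult by simp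
    qed
    moreover have "k mod m < m" using m by (simp add: P_def)
    then have "\<not> P (k mod m)" unfolding m_def by (rule not_less_Least)
    ultimately show "m dvd k" by (auto simp: P_def)
  qed (use mult in \<open>auto elim!: dvdE\<close>)
  then show ?thesis using m unfolding P_def by blast
qed

lemma restrict_sigma_mem_embeddings: "restrict (\<sigma> ^^ i) K \<in> embeddings K"
  using subfield_K field_hom_on_mono[OF sigma_pow_on_L K_sub_L] by (rule restrict_mem_embeddings)

text \<open>Cancelling the injective \<open>\<sigma> ^^ i\<close> from an equality of restrictions
  would make \<open>j - i\<close>, between 0 and \<open>m\<close>, an exponent that fixes
  \<open>K\<close>.\<close>

lemma inj_on_restrict_sigma:
  assumes "\<And>k. (\<forall>x\<in>K. (\<sigma> ^^ k) x = x) \<longleftrightarrow> m dvd k"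
  shows "inj_on (\<lambda>i. restrict (\<sigma> ^^ i) K) {..<m}"
proof -
  have ne: "restrict (\<sigma> ^^ i) K \<noteq> restrict (\<sigma> ^^ j) K" if ij: "i < j" "j < m" for i j
  proof
    assume eq: "restrict (\<sigma> ^^ i) K = restrict (\<sigma> ^^ j) K"
    have "(\<sigma> ^^ (j - i)) x = x" if x: "x \<in> K" for x
    proof -
      have xL: "x \<in> L" using x K_sub_L by blast
      have "(\<sigma> ^^ i) ((\<sigma> ^^ (j - i)) x) = (\<sigma> ^^ j) x"
        using ij by (metis comp_apply funpow_add le_add_diff_inverse less_imp_le)
      also have "\<dots> = (\<sigma> ^^ i) x" using fun_cong[OF eq, of x] x by simp
      finally show ?thesis
        using hom_inj[OF subfield_L sigma_pow_on_L sigma_pow_in_L[OF xL] xL] by blast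
    qed
    then have "m dvd j - i" using assms by blast
    then show False using ij by (auto dest: dvd_imp_le)
  qed
  show ?thesis
  proof (rule inj_onI)
    fix i j assume "i \<in> {..<m}" "j \<in> {..<m}" "restrict (\<sigma> ^^ i) K = restrict (\<sigma> ^^ j) K"
    then show "i = j" using ne[of i j] ne[of j i] by (cases i j rule: linorder_cases) auto
  qed
qed

text \<open>The order of \<open>\<sigma>\<close> on \<open>K\<close> is at most \<open>s\<close> by independence of embeddings, and at least \<open>s\<close>
  because the field fixed by \<open>\<sigma> ^^ m\<close> is spanned by the \<open>m\<close> periods.\<close>

lemma sigma_pow_fixes_K_iff: "(\<forall>x\<in>K. (\<sigma> ^^ k) x = x) \<longleftrightarrow> s dvd k"
  and s_dvd: "s dvd p - 1"
proof -
  obtain m where m: "m > 0" "\<And>k. (\<forall>x\<in>K. (\<sigma> ^^ k) x = x) \<longleftrightarrow> m dvd k"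
    using fixing_exponents by metis
  have "(\<forall>x\<in>K. (\<sigma> ^^ (p - 1)) x = x)"
    using K_sub_L sigma_period_id unfolding L_eq_zeta_span by auto
  then have mdvd: "m dvd p - 1" by (simp add: m(2))
  have "card ((\<lambda>i. restrict (\<sigma> ^^ i) K) ` {..<m}) \<le> card (embeddings K)"
    using card_embeddings_le_degree[OF subfield_K] degree_K s_pos
    by (intro card_mono) (auto intro: restrict_sigma_mem_embeddings)
  then have "m \<le> s"
    using card_embeddings_le_degree[OF subfield_K] degree_K s_pos
    by (simp add: card_image[OF inj_on_restrict_sigma[OF m(2)]])
  moreover have "K \<subseteq> ratvs.span (period m ` {..<m})"
    using fixed_in_period_span[OF mdvd m(1)] K_sub_L m(2)[of m] unfolding L_eq_zeta_span by auto
  then have "s \<le> card (period m ` {..<m})"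
    using ratvs.dim_le_card[of K "period m ` {..<m}"] degree_K by (simp add: field_degree_def)
  then have "s \<le> m" using card_image_le[of "{..<m}" "period m"] by simp
  ultimately have "m = s" by simp
  then show "(\<forall>x\<in>K. (\<sigma> ^^ k) x = x) \<longleftrightarrow> s dvd k" "s dvd p - 1" using m mdvd by auto
qed

text \<open>The elements fixed by \<open>\<sigma> ^^ s\<close> are spanned by \<open>s\<close>
  periods and include \<open>K\<close>, of dimension \<open>s\<close>; one outside \<open>K\<close>
  would give \<open>s + 1\<close> independent vectors there.\<close>

lemma fixed_imp_in_K:
  assumes x: "x \<in> L" and fixed: "(\<sigma> ^^ s) x = x"
  shows "x \<in> K"
proof (rule ccontr)
  assume "x \<notin> K"
  obtain B where B: "B \<subseteq> K" "ratvs.independent B" "K \<subseteq> ratvs.span B" "card B = s"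
    using ratvs.basis_exists[of K] degree_K unfolding field_degree_def by metis
  have fin: "finite B" using s_pos B(4) by (metis card_gt_0_iff)
  have "ratvs.span B \<subseteq> K" using B(1) subfield_subspace[OF subfield_K] by (rule ratvs.span_minimal)
  then have "x \<notin> ratvs.span B" using \<open>x \<notin> K\<close> by blast
  then have "ratvs.independent (insert x B)" using B(2) by (rule ratvs.independent_insertI)
  moreover have "insert x B \<subseteq> ratvs.span (period s ` {..<s})"
  proof -
    have "y \<in> ratvs.span (period s ` {..<s})" if "y \<in> L" "(\<sigma> ^^ s) y = y" for y
      using fixed_in_period_span[OF s_dvd s_pos _ that(2)] that(1) by (simp add: L_eq_zeta_span)
    then show ?thesis using x fixed B(1) K_sub_L sigma_pow_fixes_K_iff[of s] by auto
  qed
  ultimately have "card (insert x B) \<le> card (period s ` {..<s})"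
    using ratvs.independent_span_bound[of "period s ` {..<s}" "insert x B"] by auto
  also have "\<dots> \<le> s" using card_image_le[of "{..<s}" "period s"] by simp
  finally show False using fin B(1,4) \<open>x \<notin> K\<close> by (auto simp: card_insert_if split: if_splits)
qed

lemma period_in_K: "period s i \<in> K"
  using period_in_L sigma_pow_period[of s s i] period_add[OF s_dvd, of i 1]
  by (intro fixed_imp_in_K) (auto simp: add.commute)

lemma inj_on_restrict_sigma_K: "inj_on (\<lambda>i. restrict (\<sigma> ^^ i) K) {..<s}"
  using inj_on_restrict_sigma sigma_pow_fixes_K_iff by blast

lemma embeddings_K: "embeddings K = (\<lambda>i. restrict (\<sigma> ^^ i) K) ` {..<s}"
  using card_embeddings_le_degree[OF subfield_K] degree_K s_pos
  by (intro card_seteq[symmetric])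
    (auto simp: card_image[OF inj_on_restrict_sigma_K] intro: restrict_sigma_mem_embeddings)

lemma sum_embeddings_K: "(\<Sum>\<tau>\<in>embeddings K. f \<tau>) = (\<Sum>i<s. f (restrict (\<sigma> ^^ i) K))"
  unfolding embeddings_K by (simp add: sum.reindex[OF inj_on_restrict_sigma_K])

lemma card_embeddings_K: "card (embeddings K) = s"
  unfolding embeddings_K by (simp add: card_image[OF inj_on_restrict_sigma_K])

text \<open>The embeddings fixing \<open>K\<close> are the powers of \<open>\<sigma> ^^ s\<close>;
  applied to \<open>\<zeta> = g 0\<close> they give the summands of the period.\<close>

lemma relative_trace_zeta: "relative_trace L K \<zeta> = period s 0"
proof -
  define c where "c = (p - 1) div s"
  have sc: "s * c = p - 1" using s_dvd by (simp add: c_def)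
  have "{\<tau> \<in> embeddings L. \<forall>y\<in>K. \<tau> y = y} = (\<lambda>l. restrict (\<sigma> ^^ (s * l)) L) ` {..<c}"
  proof -
    have "(\<forall>y\<in>K. restrict (\<sigma> ^^ j) L y = y) \<longleftrightarrow> s dvd j" for j
      using K_sub_L sigma_pow_fixes_K_iff[of j] by (metis restrict_apply' subsetD)
    then have "{\<tau> \<in> embeddings L. \<forall>y\<in>K. \<tau> y = y} =
        (\<lambda>j. restrict (\<sigma> ^^ j) L) ` {j. j < p - 1 \<and> s dvd j}"
      unfolding embeddings_L by blast
    also have "{j. j < p - 1 \<and> s dvd j} = (\<lambda>l. s * l) ` {..<c}"
      unfolding sc[symmetric] using s_pos by (auto elim!: dvdE)
    finally show ?thesis by (simp only: image_image)
  qed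
  moreover have "inj_on (\<lambda>l. restrict (\<sigma> ^^ (s * l)) L) {..<c}"
  proof (rule inj_onI)
    fix l l' assume l: "l \<in> {..<c}" "l' \<in> {..<c}"
      and eq: "restrict (\<sigma> ^^ (s * l)) L = restrict (\<sigma> ^^ (s * l')) L"
    from fun_cong[OF eq, of \<zeta>] have "g (s * l) = g (s * l')"
      using zeta_in_L sigma_pow_g[of _ 0] by (simp add: g_0)
    then have "[s * l = s * l'] (mod s * c)" by (simp add: g_eq_iff sc)
    then have "s * l = s * l'" using l s_pos by (auto simp: cong_def)
    then show "l = l'" using s_pos by simp
  qed
  ultimately have "relative_trace L K \<zeta> = (\<Sum>l<c. restrict (\<sigma> ^^ (s * l)) L \<zeta>)"
    by (simp add: relative_trace_def sum.reindex)
  also have "\<dots> = period s 0"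
    using zeta_in_L sigma_pow_g[of _ 0] by (simp add: period_def c_def g_0)
  finally show ?thesis .
qed

text \<open>The restricted map is \<open>undefined\<close> outside \<open>K\<close>, so iterating it
  relies on every period lying in \<open>K\<close>.\<close>

lemma sigma_restrict_pow_period:
  "(restrict \<sigma> K ^^ i) (period s 0) = period s i"
  by (induction i) (use sigma_pow_period[of 1 s] period_in_K in simp_all)

lemma cnj_g: "g n * cnj (g m) = \<zeta> ^ (v ^ n + (p - 1) * v ^ m)"
  by (simp add: g_def cnj_zeta power_add power_mult)

text \<open>Source of the quadratic form: the sums over embeddings and over cosets combine into
  \<open>(p - 1) div s\<close> complete traces, each -1, except that the trace of 1, present only
  for \<open>i = k\<close>, is \<open>p - 1\<close>.\<close>

lemma period_gram:
  assumes i: "i < s" and k: "k < s"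
  shows "(\<Sum>\<tau>\<in>embeddings K. \<tau> (period s i) * cnj (\<tau> (period s k))) =
    (if i = k then of_nat p else 0) - of_nat ((p - 1) div s)"
proof -
  define c where "c = (p - 1) div s"
  have sc: "c * s = p - 1" using s_dvd by (simp add: c_def)
  have "(\<Sum>\<tau>\<in>embeddings K. \<tau> (period s i) * cnj (\<tau> (period s k))) =
      (\<Sum>j<s. period s (j + i) * cnj (period s (j + k)))"
    unfolding sum_embeddings_K by (simp add: period_in_K sigma_pow_period)
  also have "\<dots> = (\<Sum>j<s. \<Sum>l<c. \<Sum>r<c. g (l * s + j + i) * cnj (g (l * s + j + (s * r + k))))"
  proof (rule sum.cong)
    fix j
    have "period s (j + i) * cnj (period s (j + k)) =
        (\<Sum>l<c. g (s * l + (j + i)) * cnj (period s (j + k)))"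
      by (simp add: period_def c_def sum_distrib_right)
    \<comment> \<open>Moving the second period by \<open>s * l\<close> leaves it unchanged and puts
      \<open>l * s + j\<close> into both indices; this number then runs through all of
      \<open>{..<p - 1}\<close>.\<close>
    also have "\<dots> = (\<Sum>l<c. g (s * l + (j + i)) * cnj (period s (j + k + s * l)))"
      by (simp add: period_add[OF s_dvd])
    also have "\<dots> = (\<Sum>l<c. \<Sum>r<c. g (s * l + (j + i)) * cnj (g (s * r + (j + k + s * l))))"
      by (simp add: period_def c_def sum_distrib_left)
    also have "\<dots> = (\<Sum>l<c. \<Sum>r<c. g (l * s + j + i) * cnj (g (l * s + j + (s * r + k))))"
      by (simp add: ac_simps)
    finally show "period s (j + i) * cnj (period s (j + k)) =
        (\<Sum>l<c. \<Sum>r<c. g (l * s + j + i) * cnj (g (l * s + j + (s * r + k))))" .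
  qed simp
  also have "\<dots> = (\<Sum>l<c. \<Sum>j<s. \<Sum>r<c. g (l * s + j + i) * cnj (g (l * s + j + (s * r + k))))"
    by (rule sum.swap)
  also have "\<dots> = (\<Sum>l<c. \<Sum>n=l * s..<l * s + s. \<Sum>r<c. g (n + i) * cnj (g (n + (s * r + k))))"
  proof (rule sum.cong)
    fix l
    show "(\<Sum>j<s. \<Sum>r<c. g (l * s + j + i) * cnj (g (l * s + j + (s * r + k)))) =
        (\<Sum>n=l * s..<l * s + s. \<Sum>r<c. g (n + i) * cnj (g (n + (s * r + k))))"
      using sum.shift_bounds_nat_ivl[of "\<lambda>n. \<Sum>r<c. g (n + i) * cnj (g (n + (s * r + k)))" 0 "l * s" s]
      by (simp add: lessThan_atLeast0 ac_simps)
  qed simp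
  also have "\<dots> = (\<Sum>n<c * s. \<Sum>r<c. g (n + i) * cnj (g (n + (s * r + k))))"
    by (rule sum.nat_group)
  also have "\<dots> = (\<Sum>r<c. \<Sum>n<p - 1. g (n + i) * cnj (g (n + (s * r + k))))"
    unfolding sc by (rule sum.swap)
  also have "\<dots> = (\<Sum>r<c. (if i = k \<and> r = 0 then of_nat p else 0) - 1)"
  proof (rule sum.cong)
    fix r assume r: "r \<in> {..<c}"
    have "g (n + i) * cnj (g (n + (s * r + k))) =
        \<zeta> ^ (v ^ n * (v ^ i + (p - 1) * v ^ (s * r + k)))" for n
      by (simp add: cnj_g power_add algebra_simps)
    then have "(\<Sum>n<p - 1. g (n + i) * cnj (g (n + (s * r + k)))) =
        (if p dvd v ^ i + (p - 1) * v ^ (s * r + k) then of_nat p - 1 else - 1)"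
      by (simp only: sum_zeta_pow_v)
    \<comment> \<open>Modulo \<open>p\<close> the factor \<open>p - 1\<close> is -1, reflecting that
      conjugation inverts roots of unity.\<close>
    also have "p dvd v ^ i + (p - 1) * v ^ (s * r + k) \<longleftrightarrow> [v ^ i = v ^ (s * r + k)] (mod p)"
    proof -
      have "int (a + (p - 1) * b) = int a - int b + int p * int b" for a b
        using p_gt_0 by (cases p) (simp_all add: algebra_simps)
      then have "int p dvd int (v ^ i + (p - 1) * v ^ (s * r + k)) \<longleftrightarrow>
          int p dvd int (v ^ i) - int (v ^ (s * r + k)) + int p * int (v ^ (s * r + k))"
        by (simp only:)
      also have "\<dots> \<longleftrightarrow> int p dvd int (v ^ i) - int (v ^ (s * r + k))"
        by (metis dvd_add_left_iff dvd_triv_left)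
      finally show ?thesis
        by (simp only: of_nat_dvd_iff flip: cong_iff_dvd_diff cong_int_iff)
    qed
    also have "\<dots> \<longleftrightarrow> [i = s * r + k] (mod c * s)" by (simp add: v_pow_eq_iff sc)
    \<comment> \<open>Both sides are below the modulus, so the congruence is an equality, and
      \<open>i < s\<close> forces \<open>r = 0\<close>.\<close>
    also have "\<dots> \<longleftrightarrow> i = k \<and> r = 0"
    proof
      assume *: "[i = s * r + k] (mod c * s)"
      have "i < c * s" using i r by (cases c) auto
      moreover have "s * r + k < s * r + s" using k by simp
      then have "s * r + k < c * s"
        using r mult_le_mono2[of "Suc r" c s] by (simp add: mult.commute)
      ultimately have "i = s * r + k" using * by (simp add: cong_def)
      then show "i = k \<and> r = 0" using i k by (cases r) auto
    qed auto
    finally show "(\<Sum>n<p - 1. g (n + i) * cnj (g (n + (s * r + k)))) =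
        (if i = k \<and> r = 0 then of_nat p else 0) - 1" by simp
  qed simp
  also have "\<dots> = (if i = k then of_nat p else 0) - of_nat c"
  proof -
    have "c > 0" using sc p_gt_1 by (cases c) auto
    then have "(\<Sum>r<c. (if i = k \<and> r = 0 then complex_of_nat p else 0)) =
        (if i = k then of_nat p else 0)"
      by (cases "i = k") simp_all
    then show ?thesis by (simp add: sum_subtractf)
  qed
  finally show ?thesis by (simp add: c_def)
qed

end

section \<open>The canonical embedding\<close>

text \<open>The characteristic polynomial of an integer matrix is monic with integer
  coefficients.\<close>

lemma algebraic_int_eigenvalue:
  fixes x :: "'a :: field_char_0"
  assumes A: "A \<in> carrier_mat n n" and w: "w \<in> carrier_vec n" "w \<noteq> 0\<^sub>v n"
    and eig: "map_mat of_int A *\<^sub>v w = x \<cdot>\<^sub>v w"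
  shows "algebraic_int x"
proof -
  let ?A = "map_mat of_int A :: 'a mat"
  have "eigenvalue ?A x"
    using A w eig unfolding eigenvalue_def eigenvector_def by auto
  then have "poly (char_poly ?A) x = 0"
    using A eigenvalue_root_char_poly[of ?A n x] by simp
  then have "poly (map_poly of_int (char_poly A)) x = 0"
    by (simp add: of_int_hom.char_poly_hom[OF A])
  moreover have "lead_coeff (char_poly A) = 1"
    using degree_monic_char_poly[OF A] by simp
  ultimately show ?thesis unfolding algebraic_int_altdef_ipoly by blast
qed

text \<open>Separates the coordinates from their argument, so that a row of the basis matrix can be
  treated as one additive function.\<close>

definition coordinate_functions ::
    "(complex \<Rightarrow> complex) list \<Rightarrow> (complex \<Rightarrow> complex) list \<Rightarrow> (complex \<Rightarrow> real) list" where
  "coordinate_functions rs cs = map (\<lambda>\<tau> x. Re (\<tau> x)) rs @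
     concat (map (\<lambda>\<tau>. [\<lambda>x. Re (\<tau> x), \<lambda>x. Im (\<tau> x)]) cs)"

lemma canonical_embedding_eq:
  "canonical_embedding rs cs x = vec_of_list (map (\<lambda>f. f x) (coordinate_functions rs cs))"
  by (simp add: canonical_embedding_def coordinate_functions_def map_concat o_def)

lemma length_coordinate_functions:
  "length (coordinate_functions rs cs) = length rs + 2 * length cs"
  by (simp add: coordinate_functions_def length_concat o_def sum_list_triv mult.commute)

text \<open>For complex a and b, the products of the real and of the imaginary parts add up to
  \<open>Re (a * cnj b)\<close>.\<close>

lemma canonical_embedding_scalar_prod:
  assumes "distinct rs" and "distinct cs"
  shows "canonical_embedding rs cs x \<bullet> canonical_embedding rs cs y =
    (\<Sum>\<tau>\<in>set rs. Re (\<tau> x) * Re (\<tau> y)) + (\<Sum>\<tau>\<in>set cs. Re (\<tau> x * cnj (\<tau> y)))"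
proof -
  let ?f = "coordinate_functions rs cs"
  have "canonical_embedding rs cs x \<bullet> canonical_embedding rs cs y = (\<Sum>f\<leftarrow>?f. f x * f y)"
    by (auto simp: canonical_embedding_eq scalar_prod_def vec_of_list_index sum_list_sum_nth
        intro!: sum.cong)
  also have "\<dots> = (\<Sum>\<tau>\<leftarrow>rs. Re (\<tau> x) * Re (\<tau> y)) + (\<Sum>\<tau>\<leftarrow>cs. Re (\<tau> x * cnj (\<tau> y)))"
  proof -
    have "(\<Sum>f\<leftarrow>concat (map (\<lambda>\<tau>. [\<lambda>x. Re (\<tau> x), \<lambda>x. Im (\<tau> x)]) cs). f x * f y) =
        (\<Sum>\<tau>\<leftarrow>cs. Re (\<tau> x * cnj (\<tau> y)))"
      by (induction cs) simp_all
    then show ?thesis by (simp add: coordinate_functions_def o_def)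
  qed
  finally show ?thesis using assms by (simp add: sum_list_distinct_conv_sum_set)
qed

section \<open>Integrality of the periods\<close>

context cyclotomic
begin

text \<open>The ring Z[\<zeta>]. With all \<open>p\<close> powers as generators, any power is
  rewritten by reducing its exponent modulo \<open>p\<close>; coefficients are not unique.\<close>

definition zeta_int_span :: "complex set" where
  "zeta_int_span = {x. \<exists>n :: nat \<Rightarrow> int. x = (\<Sum>k<p. of_int (n k) * \<zeta> ^ k)}"

lemma zeta_pow_in_int_span: "\<zeta> ^ a \<in> zeta_int_span"
proof -
  have "(\<Sum>k<p. of_int (if k = a mod p then 1 else 0) * \<zeta> ^ k) = \<zeta> ^ (a mod p)"
    using p_gt_0 by (simp add: if_distrib if_distribR cong: if_cong)
  then show ?thesis
    unfolding zeta_int_span_def zeta_pow_mod by (intro CollectI exI) (rule sym)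
qed

lemma sum_in_zeta_int_span:
  assumes "\<And>i. i \<in> A \<Longrightarrow> y i \<in> zeta_int_span"
  shows "(\<Sum>i\<in>A. of_int (c i) * y i) \<in> zeta_int_span"
proof -
  have "\<forall>i\<in>A. \<exists>n :: nat \<Rightarrow> int. y i = (\<Sum>k<p. of_int (n k) * \<zeta> ^ k)"
    using assms by (auto simp: zeta_int_span_def)
  then obtain n :: "'a \<Rightarrow> nat \<Rightarrow> int" where n: "\<And>i. i \<in> A \<Longrightarrow> y i = (\<Sum>k<p. of_int (n i k) * \<zeta> ^ k)"
    by metis
  have "(\<Sum>i\<in>A. of_int (c i) * y i) = (\<Sum>i\<in>A. \<Sum>k<p. of_int (c i * n i k) * \<zeta> ^ k)"
    by (intro sum.cong) (simp_all add: n sum_distrib_left mult.assoc)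
  also have "\<dots> = (\<Sum>k<p. of_int (\<Sum>i\<in>A. c i * n i k) * \<zeta> ^ k)"
    by (subst sum.swap) (simp add: sum_distrib_right)
  finally show ?thesis
    unfolding zeta_int_span_def by (intro CollectI exI)
qed

text \<open>Multiplication by \<open>x\<close> preserves the span, so the vector of powers of
  \<zeta> is an eigenvector of an integer matrix with eigenvalue \<open>x\<close>.\<close>

lemma algebraic_int_zeta_int_span:
  assumes x: "x \<in> zeta_int_span"
  shows "algebraic_int x"
proof -
  obtain n :: "nat \<Rightarrow> int" where n: "x = (\<Sum>k<p. of_int (n k) * \<zeta> ^ k)"
    using x by (auto simp: zeta_int_span_def)
  have "x * \<zeta> ^ i \<in> zeta_int_span" for i
  proof -
    have "x * \<zeta> ^ i = (\<Sum>k<p. of_int (n k) * \<zeta> ^ (k + i))"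
      unfolding n sum_distrib_right by (simp add: power_add mult.assoc)
    then show ?thesis using sum_in_zeta_int_span zeta_pow_in_int_span by metis
  qed
  then have "\<forall>i. \<exists>m :: nat \<Rightarrow> int. x * \<zeta> ^ i = (\<Sum>k<p. of_int (m k) * \<zeta> ^ k)"
    by (simp add: zeta_int_span_def)
  then obtain m :: "nat \<Rightarrow> nat \<Rightarrow> int" where
    m: "\<And>i. x * \<zeta> ^ i = (\<Sum>k<p. of_int (m i k) * \<zeta> ^ k)" by metis
  show ?thesis
  proof (rule algebraic_int_eigenvalue)
    show "mat p p (\<lambda>(i, k). m i k) \<in> carrier_mat p p" by simp
    show "vec p (\<lambda>k. \<zeta> ^ k) \<in> carrier_vec p" by simp
    have "vec p (\<lambda>k. \<zeta> ^ k) $ 0 \<noteq> 0\<^sub>v p $ 0" using p_gt_0 by simp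
    then show "vec p (\<lambda>k. \<zeta> ^ k) \<noteq> 0\<^sub>v p" by metis
    show "map_mat of_int (mat p p (\<lambda>(i, k). m i k)) *\<^sub>v vec p (\<lambda>k. \<zeta> ^ k) =
        x \<cdot>\<^sub>v vec p (\<lambda>k. \<zeta> ^ k)"
      by (intro eq_vecI) (auto simp: scalar_prod_def m atLeast0LessThan)
  qed
qed

lemma period_in_zeta_int_span: "period m i \<in> zeta_int_span"
  using sum_in_zeta_int_span[of "{..<(p - 1) div m}" "\<lambda>l. g (m * l + i)" "\<lambda>_. 1"]
    zeta_pow_in_int_span
  by (simp add: period_def g_def)

end

section \<open>Real and complex embeddings of \<open>K\<close>\<close>

context cyclotomic_subfield
begin

text \<open>Conjugation commutes with the powers of \<sigma>, so whether the image of
  \<open>x\<close> is real does not depend on the embedding.\<close>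

lemma real_embeddings_cases:
  "real_embeddings K = embeddings K \<or> real_embeddings K = {}"
proof -
  obtain h where h: "\<And>x. x \<in> L \<Longrightarrow> cnj x = (\<sigma> ^^ h) x" using cnj_eq_sigma_pow by blast
  have real_iff: "restrict (\<sigma> ^^ i) K x \<in> \<real> \<longleftrightarrow> cnj x = x" if x: "x \<in> K" for i x
  proof -
    have xL: "x \<in> L" "cnj x \<in> L" using x K_sub_L sigma_pow_in_L h by auto
    have "cnj ((\<sigma> ^^ i) x) = (\<sigma> ^^ i) (cnj x)"
      using xL h sigma_pow_in_L by (simp add: add.commute flip: funpow_add[THEN fun_cong, unfolded comp_apply])
    then have "cnj ((\<sigma> ^^ i) x) = (\<sigma> ^^ i) x \<longleftrightarrow> cnj x = x"
      using hom_inj[OF subfield_L sigma_pow_on_L xL(2,1)] by auto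
    then show ?thesis using x by (simp add: Reals_cnj_iff)
  qed
  show ?thesis
    unfolding real_embeddings_def embeddings_K using real_iff s_pos by blast
qed

lemma conj_embedding_mem:
  assumes "\<tau> \<in> embeddings K"
  shows "conj_embedding K \<tau> \<in> embeddings K" "conj_embedding K (conj_embedding K \<tau>) = \<tau>"
proof -
  have "field_hom_on K (\<lambda>x. cnj (\<tau> x))"
    using assms by (auto simp: mem_embeddings_iff field_hom_on_def)
  then show "conj_embedding K \<tau> \<in> embeddings K"
    unfolding conj_embedding_def by (rule restrict_mem_embeddings[OF subfield_K])
  show "conj_embedding K (conj_embedding K \<tau>) = \<tau>"
    using assms by (intro extensionalityI[of _ K]) (auto simp: conj_embedding_def mem_embeddings_iff)
qed

text \<open>Of each embedding and its conjugate exactly one is listed, so \<open>cs\<close> and its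
  conjugates partition the embeddings.\<close>

lemma sum_over_conjugate_pairs:
  assumes order: "embedding_order K rs cs" and no_real: "real_embeddings K = {}"
  shows "(\<Sum>\<tau>\<in>embeddings K. f \<tau>) = (\<Sum>\<tau>\<in>set cs. f \<tau> + f (conj_embedding K \<tau>))"
proof -
  have cs: "set cs \<subseteq> embeddings K"
    "\<And>\<tau>. \<tau> \<in> embeddings K \<Longrightarrow> \<tau> \<in> set cs \<longleftrightarrow> conj_embedding K \<tau> \<notin> set cs"
    using order no_real by (auto simp: embedding_order_def)
  have inj: "inj_on (conj_embedding K) (set cs)"
    using cs(1) conj_embedding_mem(2) by (metis inj_onI subsetD)
  have "embeddings K = set cs \<union> conj_embedding K ` set cs"
  proof (intro equalityI subsetI)
    fix \<tau> assume \<tau>: "\<tau> \<in> embeddings K"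
    show "\<tau> \<in> set cs \<union> conj_embedding K ` set cs"
    proof (cases "\<tau> \<in> set cs")
      case False
      then have "conj_embedding K \<tau> \<in> set cs" using cs(2)[OF \<tau>] by blast
      then show ?thesis using conj_embedding_mem(2)[OF \<tau>] by (metis UnI2 imageI)
    qed simp
  next
    fix \<tau> assume "\<tau> \<in> set cs \<union> conj_embedding K ` set cs"
    then show "\<tau> \<in> embeddings K" using cs(1) conj_embedding_mem(1) by blast
  qed
  moreover have "set cs \<inter> conj_embedding K ` set cs = {}"
    using cs by blast
  ultimately show ?thesis
    by (simp add: sum.union_disjoint sum.reindex[OF inj] sum.distrib)
qed

text \<open>The weight \<open>w\<close> is 1 if \<open>K\<close> is totally real and 2 if it is totally complex: the canonical
  embedding represents each conjugate pair once.\<close>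

lemma canonical_embedding_gram:
  assumes order: "embedding_order K rs cs"
  shows "\<exists>w::real. w > 0 \<and>
    (\<forall>x\<in>K. \<forall>y\<in>K.
      of_real (w * (canonical_embedding rs cs x \<bullet> canonical_embedding rs cs y)) =
        (\<Sum>\<tau>\<in>embeddings K. \<tau> x * cnj (\<tau> y)))"
    and "length (coordinate_functions rs cs) = s"
proof -
  let ?w = "if real_embeddings K = {} then 2 else 1 :: real"
  have "(\<forall>x\<in>K. \<forall>y\<in>K.
      of_real (?w * (canonical_embedding rs cs x \<bullet> canonical_embedding rs cs y)) =
        (\<Sum>\<tau>\<in>embeddings K. \<tau> x * cnj (\<tau> y))) \<and> length (coordinate_functions rs cs) = s"
  proof (cases "real_embeddings K = {}")
    case True
    have rs: "rs = []" using order True by (auto simp: embedding_order_def)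
    have d: "distinct cs" using order by (simp add: embedding_order_def)
    have "of_real (2 * (canonical_embedding rs cs x \<bullet> canonical_embedding rs cs y)) =
        (\<Sum>\<tau>\<in>embeddings K. \<tau> x * cnj (\<tau> y))" if xy: "x \<in> K" "y \<in> K" for x y
    proof -
      have "(\<Sum>\<tau>\<in>embeddings K. \<tau> x * cnj (\<tau> y)) =
          (\<Sum>\<tau>\<in>set cs. \<tau> x * cnj (\<tau> y) + cnj (\<tau> x * cnj (\<tau> y)))"
        using xy by (simp add: sum_over_conjugate_pairs[OF order True] conj_embedding_def)
      also have "\<dots> = (\<Sum>\<tau>\<in>set cs. of_real (2 * Re (\<tau> x * cnj (\<tau> y))))"
        by (simp only: complex_add_cnj)
      also have "\<dots> = of_real (2 * (canonical_embedding rs cs x \<bullet> canonical_embedding rs cs y))"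
        using canonical_embedding_scalar_prod[of rs cs x y] d by (simp add: rs sum_distrib_left)
      finally show ?thesis by simp
    qed
    \<comment> \<open>Pairing the constant 1 counts the embeddings.\<close>
    moreover have "card (embeddings K) = 2 * card (set cs)"
      using sum_over_conjugate_pairs[OF order True, of "\<lambda>_. 1 :: nat"] by simp
    then have "length (coordinate_functions rs cs) = s"
      using d by (simp add: length_coordinate_functions card_embeddings_K rs distinct_card)
    ultimately show ?thesis using True by simp
  next
    case False
    then have real: "real_embeddings K = embeddings K" using real_embeddings_cases by blast
    have rs: "set rs = embeddings K" "distinct rs" and cs: "cs = []"
      using order real by (auto simp: embedding_order_def)
    have "of_real (canonical_embedding rs cs x \<bullet> canonical_embedding rs cs y) =
        (\<Sum>\<tau>\<in>embeddings K. \<tau> x * cnj (\<tau> y))" if xy: "x \<in> K" "y \<in> K" for x y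
    proof -
      have "\<tau> x * cnj (\<tau> y) = of_real (Re (\<tau> x) * Re (\<tau> y))" if "\<tau> \<in> embeddings K" for \<tau>
      proof -
        have "\<tau> x \<in> \<real>" "\<tau> y \<in> \<real>"
          using that xy unfolding real[symmetric] by (auto simp: real_embeddings_def)
        then show ?thesis by (auto elim!: Reals_cases)
      qed
      then show ?thesis
        using canonical_embedding_scalar_prod[of rs cs x y] rs cs by simp
    qed
    moreover have "length (coordinate_functions rs cs) = s"
      using rs distinct_card[OF rs(2)]
      by (simp add: length_coordinate_functions card_embeddings_K cs)
    ultimately show ?thesis using False by simp
  qed
  moreover have "?w > 0" by simp
  ultimately show "\<exists>w::real. w > 0 \<and>
    (\<forall>x\<in>K. \<forall>y\<in>K.
      of_real (w * (canonical_embedding rs cs x \<bullet> canonical_embedding rs cs y)) =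
        (\<Sum>\<tau>\<in>embeddings K. \<tau> x * cnj (\<tau> y)))"
    and "length (coordinate_functions rs cs) = s" by blast+
qed

text \<open>Real and imaginary parts respect only real factors; the coefficients here are
  integers.\<close>

lemma coordinate_functions_period_sum:
  assumes f: "f \<in> set (coordinate_functions rs cs)"
    and emb: "set rs \<subseteq> embeddings K" "set cs \<subseteq> embeddings K"
  shows "f (\<Sum>i<s. of_int (a $ i) * period s i) = (\<Sum>i<s. of_int (a $ i) * f (period s i))"
proof -
  have lin: "\<tau> (\<Sum>i<s. of_int (a $ i) * period s i) = (\<Sum>i<s. of_int (a $ i) * \<tau> (period s i))"
    if "\<tau> \<in> embeddings K" for \<tau>
  proof -
    have hom: "field_hom_on K \<tau>" using that by (simp add: mem_embeddings_iff)
    show ?thesis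
      using period_in_K
      by (subst hom_sum[OF subfield_K hom])
        (simp_all add: subfield_mult subfield_of_int subfield_K hom_mult[OF subfield_K hom]
          hom_of_int[OF subfield_K hom])
  qed
  obtain \<tau> where \<tau>: "\<tau> \<in> set rs \<union> set cs" "f = (\<lambda>x. Re (\<tau> x)) \<or> f = (\<lambda>x. Im (\<tau> x))"
    using f by (auto simp: coordinate_functions_def)
  then show ?thesis using lin[of \<tau>] emb by auto
qed

theorem center_density_bound:
  fixes \<alpha> :: int
  assumes "even s" and order: "embedding_order K rs cs"
    and \<alpha>: "[\<alpha> ^ s = 1] (mod int p)"
    and distinct: "\<And>i j. i < j \<Longrightarrow> j < s \<Longrightarrow> \<not> int p dvd \<alpha> ^ j - \<alpha> ^ i"
  shows "center_density s (canonical_embedding rs cs `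
      M_module p s K (restrict \<sigma> K) (relative_trace L K \<zeta>) \<alpha>) \<ge> 1 / (2 ^ s * sqrt (real p))"
proof -
  let ?fs = "coordinate_functions rs cs" and ?can = "canonical_embedding rs cs"
  let ?comb = "\<lambda>a. \<Sum>i<s. of_int (a $ i) * period s i"
  define S where "S = {a \<in> carrier_vec s. \<forall>i\<le>s div 2. [a \<bullet> mu_vec s \<alpha> i = 0] (mod int p)}"
  obtain w :: real where w: "w > 0"
    and gram: "\<And>x y. x \<in> K \<Longrightarrow> y \<in> K \<Longrightarrow> of_real (w * (?can x \<bullet> ?can y)) =
        (\<Sum>\<tau>\<in>embeddings K. \<tau> x * cnj (\<tau> y))"
    using canonical_embedding_gram(1)[OF order] by blast
  note len = canonical_embedding_gram(2)[OF order]
  define E where "E = mat s s (\<lambda>(r, j). (?fs ! r) (period s j))"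
  have E: "E \<in> carrier_mat s s" by (simp add: E_def)
  have col_E: "col E j = ?can (period s j)" if "j < s" for j
    using that len by (intro eq_vecI) (auto simp: E_def canonical_embedding_eq vec_of_list_index)
  have "M_module p s K (restrict \<sigma> K) (relative_trace L K \<zeta>) \<alpha> = ?comb ` S"
  proof -
    \<comment> \<open>This yields the inclusion of the combinations into the module; the other one
      is the definition.\<close>
    have "?comb a \<in> integer_ring K" for a :: "int vec"
    proof -
      have "?comb a \<in> zeta_int_span"
        by (intro sum_in_zeta_int_span period_in_zeta_int_span)
      moreover have "?comb a \<in> K"
        by (intro subfield_sum subfield_mult subfield_of_int subfield_K period_in_K)
      ultimately show ?thesis by (simp add: integer_ring_def algebraic_int_zeta_int_span)
    qed
    then show ?thesis
      by (auto simp: M_module_def has_coordinates_def relative_trace_zeta S_def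
          sigma_restrict_pow_period)
  qed
  moreover have "?can (?comb a) = E *\<^sub>v map_vec of_int a" if "a \<in> S" for a
  proof (rule eq_vecI)
    fix r assume "r < dim_vec (E *\<^sub>v map_vec of_int a)"
    then have r: "r < s" by (simp add: E_def)
    have "?can (?comb a) $ r = (?fs ! r) (?comb a)"
      using r len by (simp add: canonical_embedding_eq vec_of_list_index)
    also have "\<dots> = (\<Sum>i<s. of_int (a $ i) * (?fs ! r) (period s i))"
      using order r len
      by (intro coordinate_functions_period_sum[of _ rs cs])
        (auto simp: embedding_order_def real_embeddings_def)
    also have "\<dots> = (E *\<^sub>v map_vec of_int a) $ r"
      using r that
      by (auto simp: E_def S_def scalar_prod_def atLeast0LessThan mult.commute intro!: sum.cong)
    finally show "?can (?comb a) $ r = (E *\<^sub>v map_vec of_int a) $ r" .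
  qed (use len in \<open>simp add: E_def canonical_embedding_eq\<close>)
  ultimately have lattice: "?can ` M_module p s K (restrict \<sigma> K) (relative_trace L K \<zeta>) \<alpha> =
      (\<lambda>a. E *\<^sub>v map_vec of_int a) ` S"
    by (simp add: image_image)
  have "transpose_mat E * E =
      (1 / w) \<cdot>\<^sub>m scalar_minus_const_mat s (real p) (real ((p - 1) div s))"
  proof (rule eq_matI)
    fix i k assume "i < dim_row ((1 / w) \<cdot>\<^sub>m scalar_minus_const_mat s (real p) (real ((p - 1) div s)))"
      "k < dim_col ((1 / w) \<cdot>\<^sub>m scalar_minus_const_mat s (real p) (real ((p - 1) div s)))"
    then have ik: "i < s" "k < s" by simp_all
    have "complex_of_real (w * (?can (period s i) \<bullet> ?can (period s k))) =
        of_real ((if i = k then real p else 0) - real ((p - 1) div s))"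
      unfolding gram[OF period_in_K period_in_K] period_gram[OF ik] by simp
    then have "w * (?can (period s i) \<bullet> ?can (period s k)) =
        (if i = k then real p else 0) - real ((p - 1) div s)"
      by (simp only: of_real_eq_iff)
    then show "(transpose_mat E * E) $$ (i, k) =
        ((1 / w) \<cdot>\<^sub>m scalar_minus_const_mat s (real p) (real ((p - 1) div s))) $$ (i, k)"
      using E ik w col_E by (simp add: scalar_minus_const_mat_def field_simps)
  qed (use E in simp_all)
  from center_density_ge_of_gram[OF prime_p \<open>even s\<close> s_pos _ w E this \<alpha> distinct]
  show ?thesis using s_dvd unfolding lattice S_def by simp
qed

end

section \<open>Reduction of the given data to residues modulo \<open>p\<close>\<close>

theorem mainTheorem4:
  fixes p s :: nat and \<zeta> t :: complex and L K :: "complex set"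
    and u \<beta> \<alpha> :: int and \<sigma>u \<theta> :: "complex \<Rightarrow> complex"
    and rs cs :: "(complex \<Rightarrow> complex) list"
  assumes "prime p"
    and "s > 0" and "even s" and "s dvd p - 1"
    and "primitive_root_of_unity p \<zeta>"
    and "L = rat_adjoin \<zeta>"
    and "complex_subfield K" and "K \<subseteq> L" and "field_degree K = s"
    and "generates_units_mod p u"
    and "\<sigma>u \<in> automorphisms L" and "\<sigma>u \<zeta> = \<zeta> powi u"
    and "\<theta> = restrict \<sigma>u K"
    and "t = relative_trace L K \<zeta>"
    and "primitive_root_mod p \<beta>"
    and "\<alpha> = \<beta> ^ ((p - 1) div s)"
    and "embedding_order K rs cs"
  shows "center_density s (canonical_embedding rs cs ` M_module p s K \<theta> t \<alpha>)
           \<ge> 1 / (2 ^ s * sqrt (real p))"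
proof -
  \<comment> \<open>\<open>u\<close> may be negative; its least residue gives the same power of
    \<zeta> with a natural exponent.\<close>
  define v where "v = nat (u mod int p)"
  have p0: "p > 0" and p1: "p > 1"
    using prime_gt_1_nat[OF \<open>prime p\<close>] by auto
  have v: "int v = u mod int p" using p0 by (simp add: v_def)
  have vu: "[int v ^ k = u ^ k] (mod int p)" for k
    unfolding v by (simp add: cong_def power_mod)
  have zp: "\<zeta> ^ p = 1" and z0: "\<zeta> \<noteq> 0"
    using \<open>primitive_root_of_unity p \<zeta>\<close> p0 by (auto simp: primitive_root_of_unity_def power_0_left)
  have "\<zeta> powi u = \<zeta> powi (int p * (u div int p) + int v)" by (simp add: v)
  also have "\<dots> = (\<zeta> powi int p) powi (u div int p) * \<zeta> powi int v"
    using z0 by (simp only: power_int_add power_int_mult simp_thms)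
  also have "\<dots> = \<zeta> ^ v" by (simp add: zp)
  finally have zv: "\<sigma>u \<zeta> = \<zeta> ^ v" using \<open>\<sigma>u \<zeta> = \<zeta> powi u\<close> by simp
  interpret cyclotomic_subfield p v \<zeta> L \<sigma>u K s
  proof
    show "coprime v p"
      using \<open>generates_units_mod p u\<close> unfolding generates_units_mod_def
      by (metis coprime_int_iff coprime_mod_left_iff p0 v of_nat_0_eq_iff less_irrefl)
    show "\<exists>k. [v ^ k = c] (mod p)" if "coprime c p" for c
    proof -
      have "coprime (int c) (int p)" using that by simp
      then obtain k where "[u ^ k = int c] (mod int p)"
        using \<open>generates_units_mod p u\<close> unfolding generates_units_mod_def by blast
      then have "[int (v ^ k) = int c] (mod int p)" using vu[of k] by (auto intro: cong_trans)
      then show ?thesis unfolding cong_int_iff by blast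
    qed
    show "field_hom_on L \<sigma>u" "\<sigma>u ` L \<subseteq> L"
      using \<open>\<sigma>u \<in> automorphisms L\<close>
      by (auto simp: automorphisms_def mem_embeddings_iff bij_betw_def)
  qed (use assms zv in simp_all)
  \<comment> \<open>The order of \<beta> is that of its least residue, so powers of \<alpha> are
    compared through powers of \<open>b\<close>.\<close>
  define b where "b = nat (\<beta> mod int p)"
  have ord_b: "ord p b = p - 1"
    using \<open>primitive_root_mod p \<beta>\<close> by (simp add: primitive_root_mod_def b_def)
  define c where "c = (p - 1) div s"
  have cs: "c * s = p - 1" using \<open>s dvd p - 1\<close> by (simp add: c_def)
  have \<alpha>b: "[\<alpha> ^ i = int (b ^ (c * i))] (mod int p)" for i
  proof -
    have "int b = \<beta> mod int p" using p0 by (simp add: b_def)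
    then have "[\<beta> ^ (c * i) = int b ^ (c * i)] (mod int p)"
      by (simp add: cong_def power_mod)
    then show ?thesis by (simp add: \<open>\<alpha> = _\<close> c_def power_mult)
  qed
  have cop: "coprime p b" using ord_b p1 ord_eq_0[of p b] by fastforce
  have "[\<alpha> ^ s = 1] (mod int p)"
  proof -
    have "[b ^ (c * s) = 1] (mod p)" unfolding cs using ord_works[of b p] ord_b by simp
    then have "[int (b ^ (c * s)) = int 1] (mod int p)" by (simp only: cong_int_iff)
    then show ?thesis using \<alpha>b[of s] by (auto intro: cong_trans)
  qed
  \<comment> \<open>Since \<open>b\<close> has order \<open>c * s\<close>, its power
    \<open>b ^ c\<close> has order \<open>s\<close>, and the first \<open>s\<close> powers of
    \<alpha> are distinct modulo \<open>p\<close>.\<close>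
  moreover have "\<not> int p dvd \<alpha> ^ j - \<alpha> ^ i" if ij: "i < j" "j < s" for i j
  proof
    assume "int p dvd \<alpha> ^ j - \<alpha> ^ i"
    then have "[\<alpha> ^ j = \<alpha> ^ i] (mod int p)" by (simp add: cong_iff_dvd_diff)
    then have "[int (b ^ (c * j)) = int (b ^ (c * i))] (mod int p)"
      using \<alpha>b by (meson cong_sym cong_trans)
    then have "[b ^ (c * j) = b ^ (c * i)] (mod p)" by (simp only: cong_int_iff)
    then have "[c * j = c * i] (mod c * s)"
      using order_divides_expdiff[OF cop] by (simp add: ord_b cs)
    moreover have "c > 0" using cs p1 by (cases c) auto
    ultimately show False using ij by (simp add: cong_def)
  qed
  ultimately have "center_density s (canonical_embedding rs cs `
      M_module p s K (restrict \<sigma>u K) (relative_trace L K \<zeta>) \<alpha>) \<ge> 1 / (2 ^ s * sqrt (real p))"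
    using center_density_bound \<open>even s\<close> \<open>embedding_order K rs cs\<close> by blast
  then show ?thesis unfolding \<open>\<theta> = _\<close> \<open>t = _\<close> .
qed

end
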